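(* Let $n\ge1$, let $(\Omega_j,\mu_j)$, $1\le j\le n$, be measure spaces, let $0<q<p_1,\ldots,p_n\le\infty$, and put $\alpha_j=\frac1q-\frac1{p_j}$ and $Y_j=L_{p_j,\infty}(\mu_j;L_q(\widehat\mu_j))$. Then a measurable function $f\colon\Omega_1\times\cdots\times\Omega_n\to\mathbb{R}$ belongs to $Y_1+\cdots+Y_n$ if and only if $$\sup_{E_j\subset\Omega_j}\left(\int_{E_1\times\cdots\times E_n}|f|^q\,d\mu_1\cdots d\mu_n\right)^{1/q}\left(\mu_1(E_1)^{\alpha_1}+\cdots+\mu_n(E_n)^{\alpha_n}\right)^{-1}<\infty.$$ Moreover, the generalized $K$-functional $$K(t_1,\ldots,t_n)=\inf\{t_1\|x_1\|_{Y_1}+\cdots+t_n\|x_n\|_{Y_n} : f=x_1+\cdots+x_n,\ x_j\in Y_j\}$$ is equivalent, up to positive multiplicative constants $c,C$ independent of $t=(t_1,\ldots,t_n)\in(0,\infty)^n$ (and of $f$), to $$\sup_{E_j\subset\Omega_j}\left(\int_{E_1\times\cdots\times E_n}|f|^q\,d\mu_1\cdots d\mu_n\right)^{1/q}\left(t_1^{-1}\mu_1(E_1)^{\alpha_1}+\cdots+t_n^{-1}\mu_n(E_n)^{\alpha_n}\right)^{-1}.$$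
   Context: Conventions: $1/\infty=0$; $\widehat\mu_j=\mu_1\times\cdots\times\mu_{j-1}\times\mu_{j+1}\times\cdots\times\mu_n$ is the product of all the measures except $\mu_j$. Suprema are over measurable subsets $E_j\subset\Omega_j$ ($1\le j\le n$) and are understood as the least $k\in[0,\infty]$ such that the $L_q$-type integral factor is at most $k$ times the sum in the second factor's parentheses, for all choices of $E_1,\ldots,E_n$. For a measure space $(\Omega,\mu)$ and $0<p<\infty$, $\|h\|_{p,\infty}=\sup_{c>0}\big(c^p\mu\{|h|>c\}\big)^{1/p}$; for $p=\infty$, $L_{\infty,\infty}=L_\infty$. The space $L_{p_j,\infty}(\mu_j;L_q(\widehat\mu_j))$ consists of the measurable functions $g$ on $\Omega_1\times\cdots\times\Omega_n$ such that the function sending $\omega_j\in\Omega_j$ to the $L_q(\widehat\mu_j)$ (quasi-)norm of $g$ in the remaining variables belongs to $L_{p_j,\infty}(\mu_j)$, with (quasi-)norm the $L_{p_j,\infty}(\mu_j)$ quasi-norm of that function. The infimum defining $K$ is $+\infty$ if $f\notin Y_1+\cdots+Y_n$.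
   Formalization: The measure spaces are assumed sigma-finite, so that product measures and Tonelli make sense; for arbitrary measure spaces the claim fails (n=1, one point of infinite mass, f=1, q=1, p=∞ gives supremum 0 but K(t)=t). *)

theory Defs
  imports "HOL-Probability.Essential_Supremum"
begin

(* Intended only for exponents a > 0: then 0 is sent to 0 and top to top. *)
definition enn_powr :: "ennreal \<Rightarrow> real \<Rightarrow> ennreal" where
  "enn_powr x a = (if x = top then top else ennreal (enn2real x powr a))"

definition Lq_norm :: "real \<Rightarrow> 'b measure \<Rightarrow> ('b \<Rightarrow> real) \<Rightarrow> ennreal" where
  "Lq_norm q N h = enn_powr (\<integral>\<^sup>+ y. ennreal (\<bar>h y\<bar> powr q) \<partial>N) (1 / q)"

(* The functions h here take values in [0, top]; p = top gives the L_infinity norm. *)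
definition weak_Lp_norm :: "ennreal \<Rightarrow> 'a measure \<Rightarrow> ('a \<Rightarrow> ennreal) \<Rightarrow> ennreal" where
  "weak_Lp_norm p N h =
     (if p = top then esssup N h
      else (SUP c\<in>{0<..}. enn_powr (ennreal (c powr enn2real p)
                 * emeasure N {x \<in> space N. ennreal c < h x}) (1 / enn2real p)))"

(* The exponent alpha = 1/q - 1/p; in ennreal, 1 / top = 0. *)
definition gap_exponent :: "real \<Rightarrow> ennreal \<Rightarrow> real" where
  "gap_exponent q p = 1 / q - enn2real (1 / p)"

(* The product of the spaces M 1, ..., M n consists of the extensional functions on {1..n};
   y(j := w) is the point whose j-th coordinate is w and whose other coordinates are those of y. *)
definition Y_norm ::
  "nat \<Rightarrow> (nat \<Rightarrow> 'a measure) \<Rightarrow> real \<Rightarrow> (nat \<Rightarrow> ennreal) \<Rightarrow> nat \<Rightarrow> ((nat \<Rightarrow> 'a) \<Rightarrow> real) \<Rightarrow> ennreal"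
where
  "Y_norm n M q p j g =
     weak_Lp_norm (p j) (M j)
       (\<lambda>w. Lq_norm q (PiM ({1..n} - {j}) M) (\<lambda>y. g (y(j := w))))"

definition Y_space ::
  "nat \<Rightarrow> (nat \<Rightarrow> 'a measure) \<Rightarrow> real \<Rightarrow> (nat \<Rightarrow> ennreal) \<Rightarrow> nat \<Rightarrow> ((nat \<Rightarrow> 'a) \<Rightarrow> real) set"
where
  "Y_space n M q p j = {g \<in> borel_measurable (PiM {1..n} M). Y_norm n M q p j g < top}"

definition Y_decompositions ::
  "nat \<Rightarrow> (nat \<Rightarrow> 'a measure) \<Rightarrow> real \<Rightarrow> (nat \<Rightarrow> ennreal) \<Rightarrow> ((nat \<Rightarrow> 'a) \<Rightarrow> real) \<Rightarrow>
     (nat \<Rightarrow> (nat \<Rightarrow> 'a) \<Rightarrow> real) set"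
where
  "Y_decompositions n M q p f =
     {x. (\<forall>j\<in>{1..n}. x j \<in> Y_space n M q p j) \<and>
         (\<forall>\<omega>\<in>space (PiM {1..n} M). f \<omega> = (\<Sum>j=1..n. x j \<omega>))}"

definition Y_sum ::
  "nat \<Rightarrow> (nat \<Rightarrow> 'a measure) \<Rightarrow> real \<Rightarrow> (nat \<Rightarrow> ennreal) \<Rightarrow> ((nat \<Rightarrow> 'a) \<Rightarrow> real) set"
where
  "Y_sum n M q p = {f. Y_decompositions n M q p f \<noteq> {}}"

definition K_functional ::
  "nat \<Rightarrow> (nat \<Rightarrow> 'a measure) \<Rightarrow> real \<Rightarrow> (nat \<Rightarrow> ennreal) \<Rightarrow> (nat \<Rightarrow> real) \<Rightarrow>
     ((nat \<Rightarrow> 'a) \<Rightarrow> real) \<Rightarrow> ennreal"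
where
  "K_functional n M q p t f =
     (INF x\<in>Y_decompositions n M q p f. \<Sum>j=1..n. ennreal (t j) * Y_norm n M q p j (x j))"

(* The supremum over measurable E_j of the quotient
     (integral of |f|^q over E_1 x ... x E_n)^(1/q) / (sum of t_j^(-1) mu_j(E_j)^(alpha_j)),
   read as the least k in [0, top] with numerator \<le> k * denominator for all E.
   This avoids giving a value to the quotients 0/0 and top/top. *)
definition rect_sup ::
  "nat \<Rightarrow> (nat \<Rightarrow> 'a measure) \<Rightarrow> real \<Rightarrow> (nat \<Rightarrow> ennreal) \<Rightarrow> (nat \<Rightarrow> real) \<Rightarrow>
     ((nat \<Rightarrow> 'a) \<Rightarrow> real) \<Rightarrow> ennreal"
where
  "rect_sup n M q p t f =
     Inf {k. \<forall>E. (\<forall>j\<in>{1..n}. E j \<in> sets (M j)) \<longrightarrow>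
            enn_powr (\<integral>\<^sup>+ \<omega>\<in>Pi\<^sub>E {1..n} E. ennreal (\<bar>f \<omega>\<bar> powr q) \<partial>PiM {1..n} M) (1 / q)
            \<le> k * (\<Sum>j=1..n. ennreal (1 / t j) *
                     enn_powr (emeasure (M j) (E j)) (gap_exponent q (p j)))}"

end

theory Submission
  imports Defs
begin

text \<open>Write \<open>F\<close> for \<open>\<bar>f\<bar>\<close> raised to the power \<open>q\<close>, \<open>\<alpha>\<^sub>j\<close> for the gap exponents, and let \<open>k\<close> exceed the supremum
over boxes. The bound \<open>K \<le> C k\<close> comes from splitting the product space into disjoint
sets \<open>A\<^sub>1, \<dots>, A\<^sub>n\<close> and taking \<open>x\<^sub>j = f\<close> on \<open>A\<^sub>j\<close> and \<open>0\<close> elsewhere. The sets are found by peeling.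

For an integer \<open>l\<close>, let \<open>m\<^sub>j(l)\<close> be the measure at which the \<open>j\<close>-th term
\<open>(k / t\<^sub>j) m powr \<alpha>\<^sub>j\<close> equals \<open>2 powr l\<close>. By hypothesis a box \<open>E\<close> whose sides satisfy
\<open>\<mu>\<^sub>j(E\<^sub>j) \<le> m\<^sub>j(l + 1)\<close> carries \<open>F\<close>-mass at most \<open>S = (n 2 powr (l + 1)) powr q\<close>. Keep in each side only
the points over which the slice integral of \<open>F\<close> inside the box exceeds \<open>2 S / m\<^sub>j(l)\<close>. By Markov's
inequality at most \<open>m\<^sub>j(l) / 2\<close> survives, so the smaller box has scale \<open>l\<close> and the
procedure can be repeated. A point of the product space is assigned to the first
coordinate \<open>j\<close> that is peeled off. The slice of \<open>A\<^sub>j\<close> over a point that is peeled between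
the scales \<open>l + 1\<close> and \<open>l\<close> lies in the box of scale \<open>l + 1\<close>, so its \<open>F\<close>-mass is at most
\<open>2 S / m\<^sub>j(l)\<close>, while the points that survive this step form a set of measure at most \<open>m\<^sub>j(l)\<close>. These two
facts for all \<open>l\<close> are exactly a weak-type bound for \<open>x\<^sub>j\<close>, and the powers of two are chosen so
that the bound is a constant multiple of \<open>k / t\<^sub>j\<close>.

In infinite measure there is no scale to start from. Therefore the boxes are built from below:
each scale receives a share \<open>B l\<close>, of measure at most \<open>m\<^sub>j(l) / 2\<close>, of a sigma-finite exhaustion, the
peeling is run on finitely many scales, and the number of scales is sent to infinity. Peeling
is monotone and commutes with increasing unions, which makes the limit a family \<open>E\<close> with
\<open>peel l (E (l + 1)) \<subseteq> E l\<close> (\<open>layers_exist\<close>, \<open>partition_exists\<close>, \<open>K_functional_le\<close>).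

For the other inequality, a function in weak \<open>L\<^sub>p\<close> with \<open>p > q\<close> satisfies the Hoelder-type estimate of
\<open>Lq_le_weak_Lp\<close> on every set \<open>E\<close>, by a dyadic decomposition of its range. Applying this to the
slice norms of the summands of any decomposition of \<open>f\<close>, together with the quasi-triangle
inequality for \<open>L\<^sub>q\<close>, bounds the supremum over boxes (\<open>rect_sup_le_decomposition\<close>).\<close>

section \<open>Powers of extended nonnegative reals\<close>

lemma enn_powr_ennreal: "0 \<le> r \<Longrightarrow> enn_powr (ennreal r) a = ennreal (r powr a)"
  by (simp add: enn_powr_def)

lemma enn_powr_top [simp]: "enn_powr top a = top"
  by (simp add: enn_powr_def)

lemma enn_powr_zero [simp]: "enn_powr 0 a = 0"
  by (simp add: enn_powr_def)

lemma enn_powr_enn_powr: "enn_powr (enn_powr x a) b = enn_powr x (a * b)"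
  by (cases x) (auto simp: enn_powr_ennreal powr_powr)

lemma enn_powr_one [simp]: "enn_powr x 1 = x"
  by (cases x) (auto simp: enn_powr_ennreal)

lemma enn_powr_mono:
  assumes "0 \<le> a" "x \<le> y" shows "enn_powr x a \<le> enn_powr y a"
proof (cases y)
  case (real s)
  with assms obtain r where "x = ennreal r" "0 \<le> r" by (cases x) (auto simp: top_unique)
  with real assms show ?thesis by (auto simp: enn_powr_ennreal intro!: ennreal_leI powr_mono2)
qed auto

lemma enn_powr_inverse: "0 < a \<Longrightarrow> enn_powr (enn_powr x a) (1 / a) = x"
  "0 < a \<Longrightarrow> enn_powr (enn_powr x (1 / a)) a = x"
  by (simp_all add: enn_powr_enn_powr)

lemma enn_powr_le_iff: "0 < a \<Longrightarrow> enn_powr x a \<le> y \<longleftrightarrow> x \<le> enn_powr y (1 / a)"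
  using enn_powr_mono[of a x "enn_powr y (1 / a)"] enn_powr_mono[of "1 / a" "enn_powr x a" y]
  by (auto simp: enn_powr_inverse)

lemma less_enn_powr_iff: "0 < a \<Longrightarrow> y < enn_powr x a \<longleftrightarrow> enn_powr y (1 / a) < x"
  by (meson enn_powr_le_iff enn_powr_mono not_le)

lemma enn_powr_mult:
  assumes "0 < a" shows "enn_powr (x * y) a = enn_powr x a * enn_powr y a"
proof (cases x; cases y)
  fix r s :: real
  assume "x = ennreal r" "y = ennreal s" "0 \<le> r" "0 \<le> s"
  then show ?thesis
    by (simp add: enn_powr_ennreal powr_mult flip: ennreal_mult)
next
  fix r :: real
  assume "x = ennreal r" "0 \<le> r" "y = top"
  then show ?thesis
    by (cases "r = 0") (simp_all add: enn_powr_ennreal ennreal_mult_top)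
next
  fix r :: real
  assume "y = ennreal r" "0 \<le> r" "x = top"
  then show ?thesis
    by (cases "r = 0") (simp_all add: enn_powr_ennreal ennreal_top_mult)
qed simp

lemma borel_measurable_enn_powr [measurable]:
  assumes [measurable]: "h \<in> borel_measurable N"
  shows "(\<lambda>x. enn_powr (h x) a) \<in> borel_measurable N"
  unfolding enn_powr_def by measurable

text \<open>The quasi-triangle inequality. The sum is at most \<open>card J\<close> times its largest
term, which gives one constant for \<open>a \<le> 1\<close> and \<open>a > 1\<close> alike.\<close>

lemma enn_powr_sum_le:
  assumes "finite J" "0 < a"
  shows "enn_powr (\<Sum>j\<in>J. h j) a \<le> ennreal (real (card J) powr a) * (\<Sum>j\<in>J. enn_powr (h j) a)"
proof (cases "J = {}")
  case False
  then have "Max (h ` J) \<in> h ` J"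
    using assms by (intro Max_in) auto
  then obtain i where i: "i \<in> J" "h i = Max (h ` J)"
    by auto
  have max: "h j \<le> h i" if "j \<in> J" for j
    using that assms i by simp
  have "(\<Sum>j\<in>J. h j) \<le> of_nat (card J) * h i"
    using max by (rule sum_bounded_above)
  then have "enn_powr (\<Sum>j\<in>J. h j) a \<le> enn_powr (of_nat (card J) * h i) a"
    using assms by (intro enn_powr_mono) auto
  also have "\<dots> = ennreal (real (card J) powr a) * enn_powr (h i) a"
    unfolding enn_powr_mult[OF assms(2)] ennreal_of_nat_eq_real_of_nat
    by (subst enn_powr_ennreal) simp_all
  also have "\<dots> \<le> ennreal (real (card J) powr a) * (\<Sum>j\<in>J. enn_powr (h j) a)"
    using assms i by (intro mult_left_mono member_le_sum) auto
  finally show ?thesis .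
qed simp

section \<open>Slices of a product measure\<close>

text \<open>The iterated integral over all coordinates except the \<open>j\<close>-th. The norm of \<open>Y_norm\<close> is
the weak norm of such a function after taking the \<open>q\<close>-th root.\<close>

definition slice_integral ::
  "'i set \<Rightarrow> ('i \<Rightarrow> 'a measure) \<Rightarrow> 'i \<Rightarrow> (('i \<Rightarrow> 'a) \<Rightarrow> ennreal) \<Rightarrow> 'a \<Rightarrow> ennreal"
where
  "slice_integral I M j F x = (\<integral>\<^sup>+ y. F (y(j := x)) \<partial>PiM (I - {j}) M)"

lemma slice_integral_product:
  assumes I: "finite I" "j \<in> I" and sf: "\<And>i. i \<in> I \<Longrightarrow> sigma_finite_measure (M i)"
    and F: "F \<in> borel_measurable (PiM I M)"
  shows measurable_slice_integral: "slice_integral I M j F \<in> borel_measurable (M j)"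
    and nn_integral_slice_integral:
      "(\<integral>\<^sup>+ x. slice_integral I M j F x \<partial>M j) = (\<integral>\<^sup>+ \<omega>. F \<omega> \<partial>PiM I M)"
proof -
  \<comment> \<open>The locale for product measures wants sigma-finiteness at every index, so factors outside \<open>I\<close> are trivial.\<close>
  define M' where "M' i = (if i \<in> I then M i else count_space {})" for i
  have "sigma_finite_measure (M' i)" for i
    using sf sigma_finite_measure_count_space_finite[of "{}"]
    by (cases "i \<in> I") (simp_all add: M'_def)
  then interpret product_sigma_finite M'
    by (rule product_sigma_finite.intro)
  have PiM_eq: "PiM J M = PiM J M'" if "J \<subseteq> I" for J
    by (rule PiM_cong) (use that in \<open>auto simp: M'_def\<close>)
  have Mj: "M j = M' j"
    using I by (simp add: M'_def)
  have ins: "insert j (I - {j}) = I" and fin: "finite (I - {j})"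
    using I by auto
  interpret S: sigma_finite_measure "PiM (I - {j}) M'"
    by (rule sigma_finite) (fact fin)
  have F': "F \<in> borel_measurable (PiM (insert j (I - {j})) M')"
    unfolding ins PiM_eq[OF order_refl, symmetric] by (rule F)
  have slice_eq: "slice_integral I M j F = (\<lambda>x. \<integral>\<^sup>+ y. F (y(j := x)) \<partial>PiM (I - {j}) M')"
    unfolding slice_integral_def PiM_eq[OF Diff_subset] ..
  have meas: "(\<lambda>z. F ((snd z)(j := fst z))) \<in> borel_measurable (M' j \<Otimes>\<^sub>M PiM (I - {j}) M')"
  proof (rule measurable_compose[OF _ F'])
    show "(\<lambda>z. (snd z)(j := fst z)) \<in> M' j \<Otimes>\<^sub>M PiM (I - {j}) M' \<rightarrow>\<^sub>M PiM (insert j (I - {j})) M'"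
      by (rule measurable_fun_upd[where J = "I - {j}"]) auto
  qed
  show "slice_integral I M j F \<in> borel_measurable (M j)"
    unfolding slice_eq Mj
    by (rule S.borel_measurable_nn_integral) (use meas in \<open>simp add: split_beta\<close>)
  show "(\<integral>\<^sup>+ x. slice_integral I M j F x \<partial>M j) = (\<integral>\<^sup>+ \<omega>. F \<omega> \<partial>PiM I M)"
    unfolding slice_eq Mj PiM_eq[OF order_refl]
    using product_nn_integral_insert_rev[OF fin _ F'] unfolding ins by simp
qed

lemma slice_integral_mono:
  assumes "\<And>y. y \<in> space (PiM (I - {j}) M) \<Longrightarrow> F (y(j := x)) \<le> G (y(j := x))"
  shows "slice_integral I M j F x \<le> slice_integral I M j G x"
  unfolding slice_integral_def by (intro nn_integral_mono assms)

lemma measurable_fun_upd_slice: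
  assumes "j \<in> I" "x \<in> space (M j)"
  shows "(\<lambda>y. y(j := x)) \<in> PiM (I - {j}) M \<rightarrow>\<^sub>M PiM I M"
  using assms by (intro measurable_fun_upd[where J = "I - {j}"]) auto

text \<open>A sigma-finite space can be exhausted as slowly as desired: the stages of a given
exhaustion are delayed until the prescribed bound \<open>m l\<close> admits them.\<close>

lemma sigma_finite_exhaustion:
  fixes m :: "int \<Rightarrow> real"
  assumes sf: "sigma_finite_measure N" and m: "mono m" "\<And>x. \<exists>l. x \<le> m l"
  obtains B where "\<And>l. B l \<in> sets N" "mono B" "\<And>l. emeasure N (B l) \<le> ennreal (m l)"
    "(\<Union>l. B l) = space N"
proof -
  interpret sigma_finite_measure N by fact
  obtain A :: "nat \<Rightarrow> 'a set" where A: "range A \<subseteq> sets N" "(\<Union>i. A i) = space N"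
    "\<And>i. emeasure N (A i) \<noteq> \<infinity>" "incseq A"
    by (rule sigma_finite_incseq) blast
  \<comment> \<open>The cut-off \<open>i \<le> nat l\<close> keeps \<open>J l\<close> finite, so that \<open>B l\<close> is a single stage \<open>A i\<close> or empty.\<close>
  define J where "J l = {i. i \<le> nat l \<and> emeasure N (A i) \<le> ennreal (m l)}" for l
  define B where "B l = (\<Union>i\<in>J l. A i)" for l
  have fin: "finite (J l)" for l unfolding J_def by simp
  show thesis
  proof
    show "B l \<in> sets N" for l unfolding B_def using A fin by (intro sets.finite_UN) auto
    show "mono B"
    proof (rule monoI)
      fix k l :: int assume "k \<le> l"
      then have "ennreal (m k) \<le> ennreal (m l)" using m by (intro ennreal_leI) (auto dest: monoD)
      with \<open>k \<le> l\<close> have "J k \<subseteq> J l" by (force simp: J_def)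
      then show "B k \<subseteq> B l" by (auto simp: B_def)
    qed
    show "emeasure N (B l) \<le> ennreal (m l)" for l
    proof (cases "J l = {}")
      case False
      have "A i \<subseteq> A (Max (J l))" if "i \<in> J l" for i
        using incseqD[OF A(4) Max_ge[OF fin that]] .
      then have "B l = A (Max (J l))"
        using Max_in[OF fin False] unfolding B_def by blast
      then show ?thesis using Max_in[OF fin False] by (simp add: J_def)
    qed (simp add: B_def)
    have "A i \<subseteq> (\<Union>l. B l)" for i
    proof -
      obtain r where r: "emeasure N (A i) = ennreal r" "0 \<le> r"
        using A(3)[of i] by (cases "emeasure N (A i)") auto
      obtain l where l: "r \<le> m l" using m by blast
      have "r \<le> m (max l (int i))" using l m(1) by (meson max.cobounded1 monoD order_trans)
      then have "i \<in> J (max l (int i))" using r by (auto simp: J_def ennreal_leI)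
      then show ?thesis by (auto simp: B_def)
    qed
    moreover have "B l \<subseteq> space N" for l
      using A(2) by (auto simp: B_def)
    ultimately show "(\<Union>l. B l) = space N"
      unfolding A(2)[symmetric] by (intro equalityI UN_least)
  qed
qed

section \<open>Peeling\<close>

text \<open>The data of the peeling argument: \<open>m l j\<close> is the size that scale \<open>l\<close> allows for the \<open>j\<close>-th side of
a box, and \<open>S l\<close> bounds the mass of \<open>F\<close> on boxes of that scale. The growth of \<open>m\<close>
lets the boxes fill the space. By \<open>S_over_m\<close> the bound for the slices over points outside the box of
scale \<open>l\<close> holds a fortiori for the points that were peeled at larger scales.\<close>

locale rectangle_bound =
  fixes I :: "'i::linorder set" and M :: "'i \<Rightarrow> 'a measure" and F :: "('i \<Rightarrow> 'a) \<Rightarrow> ennreal"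
    and m :: "int \<Rightarrow> 'i \<Rightarrow> real" and S :: "int \<Rightarrow> real"
  assumes finite_I: "finite I" and I_nonempty: "I \<noteq> {}"
    and sigma_finite_M: "\<And>j. j \<in> I \<Longrightarrow> sigma_finite_measure (M j)"
    and F_measurable [measurable]: "F \<in> borel_measurable (PiM I M)"
    and m_pos: "\<And>l j. j \<in> I \<Longrightarrow> 0 < m l j"
    and m_mono: "\<And>j. j \<in> I \<Longrightarrow> mono (\<lambda>l. m l j)"
    and m_unbounded: "\<And>j r. j \<in> I \<Longrightarrow> \<exists>l. r \<le> m l j"
    and S_pos: "\<And>l. 0 < S l"
    and S_over_m: "\<And>j. j \<in> I \<Longrightarrow> antimono (\<lambda>l. S (l + 1) / m l j)"
    and rectangle: "\<And>l E. (\<And>j. j \<in> I \<Longrightarrow> E j \<in> sets (M j)) \<Longrightarrow>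
          (\<And>j. j \<in> I \<Longrightarrow> emeasure (M j) (E j) \<le> ennreal (m l j)) \<Longrightarrow>
          (\<integral>\<^sup>+ \<omega>. F \<omega> * indicator (PiE I E) \<omega> \<partial>PiM I M) \<le> ennreal (S l)"
begin

text \<open>The factor 2 leaves room for the share of the exhaustion: by Markov's inequality the part of a
side above this level has at most half of the measure \<open>m l j\<close>.\<close>

definition level :: "int \<Rightarrow> 'i \<Rightarrow> real"
  where "level l j = 2 * S (l + 1) / m l j"

definition box_part :: "('i \<Rightarrow> 'a set) \<Rightarrow> ('i \<Rightarrow> 'a) \<Rightarrow> ennreal"
  where "box_part E \<omega> = F \<omega> * indicator (PiE I E) \<omega>"

definition peel :: "int \<Rightarrow> ('i \<Rightarrow> 'a set) \<Rightarrow> 'i \<Rightarrow> 'a set"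
  where "peel l E j = {x \<in> E j. ennreal (level l j) < slice_integral I M j (box_part E) x}"

text \<open>\<open>stage B d l\<close> is the box of scale \<open>l\<close> obtained by starting from the box \<open>B (l + d)\<close> of scale \<open>l + d\<close>
and descending \<open>d\<close> times, adding the share \<open>B\<close> of each scale on the way. Counting
the steps from below makes the stages increase with \<open>d\<close>, although their starting
points differ.\<close>

primrec stage :: "(int \<Rightarrow> 'i \<Rightarrow> 'a set) \<Rightarrow> nat \<Rightarrow> int \<Rightarrow> 'i \<Rightarrow> 'a set"
where
  "stage B 0 = B"
| "stage B (Suc d) = (\<lambda>l j. B l j \<union> peel l (stage B d (l + 1)) j)"

lemma level_pos: "j \<in> I \<Longrightarrow> 0 < level l j"
  using m_pos[of j l] S_pos[of "l + 1"] by (simp add: level_def)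

lemma level_antimono: "j \<in> I \<Longrightarrow> k \<le> l \<Longrightarrow> level l j \<le> level k j"
  using antimonoD[OF S_over_m, of j k l] by (simp add: level_def)

lemma box_part_measurable:
  assumes "\<And>j. j \<in> I \<Longrightarrow> E j \<in> sets (M j)"
  shows "box_part E \<in> borel_measurable (PiM I M)"
proof -
  have [measurable]: "PiE I E \<in> sets (PiM I M)"
    using assms finite_I by (intro sets_PiM_I_finite) auto
  show ?thesis unfolding box_part_def by measurable
qed

lemma slice_box_part_measurable:
  assumes "\<And>j. j \<in> I \<Longrightarrow> E j \<in> sets (M j)" "j \<in> I"
  shows "slice_integral I M j (box_part E) \<in> borel_measurable (M j)"
  using assms finite_I sigma_finite_M box_part_measurable by (intro measurable_slice_integral) auto

lemma peel_sets:
  assumes "\<And>j. j \<in> I \<Longrightarrow> E j \<in> sets (M j)" "j \<in> I"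
  shows "peel l E j \<in> sets (M j)"
proof -
  note [measurable] = slice_box_part_measurable[OF assms]
  have "peel l E j = E j \<inter> {x \<in> space (M j). ennreal (level l j) < slice_integral I M j (box_part E) x}"
    using sets.sets_into_space[OF assms(1)[OF assms(2)]] by (auto simp: peel_def)
  also have "\<dots> \<in> sets (M j)"
    using assms by (intro sets.Int) auto
  finally show ?thesis .
qed

lemma peel_mono:
  assumes "\<And>j. j \<in> I \<Longrightarrow> E j \<subseteq> E' j" "j \<in> I"
  shows "peel l E j \<subseteq> peel l E' j"
proof -
  have "box_part E \<omega> \<le> box_part E' \<omega>" for \<omega>
    unfolding box_part_def
    using assms by (intro mult_left_mono) (auto simp: indicator_def PiE_iff)
  then have "slice_integral I M j (box_part E) x \<le> slice_integral I M j (box_part E') x" for x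
    by (intro slice_integral_mono)
  then show ?thesis
    using assms unfolding peel_def by (auto intro: less_le_trans)
qed

lemma emeasure_peel:
  assumes E: "\<And>j. j \<in> I \<Longrightarrow> E j \<in> sets (M j)"
    and small: "\<And>j. j \<in> I \<Longrightarrow> emeasure (M j) (E j) \<le> ennreal (m (l + 1) j)" and j: "j \<in> I"
  shows "emeasure (M j) (peel l E j) \<le> ennreal (m l j / 2)"
proof -
  note [measurable] = slice_box_part_measurable[OF E j] peel_sets[OF E j]
  have "ennreal (level l j) * emeasure (M j) (peel l E j)
      = (\<integral>\<^sup>+ x. ennreal (level l j) * indicator (peel l E j) x \<partial>M j)"
    by (simp add: nn_integral_cmult_indicator)
  also have "\<dots> \<le> (\<integral>\<^sup>+ x. slice_integral I M j (box_part E) x \<partial>M j)"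
    by (intro nn_integral_mono) (auto simp: peel_def indicator_def)
  also have "\<dots> = (\<integral>\<^sup>+ \<omega>. box_part E \<omega> \<partial>PiM I M)"
    using j finite_I sigma_finite_M box_part_measurable[OF E]
    by (intro nn_integral_slice_integral) auto
  also have "\<dots> \<le> ennreal (S (l + 1))"
    unfolding box_part_def using E small by (rule rectangle)
  also have "\<dots> = ennreal (level l j) * ennreal (m l j / 2)"
    using m_pos[OF j, of l] level_pos[OF j, of l]
    by (subst ennreal_mult[symmetric]) (auto simp: level_def)
  finally show ?thesis
    using level_pos[OF j, of l] by (subst (asm) ennreal_mult_le_mult_iff) auto
qed

text \<open>Monotone convergence. The strict inequality in the definition of \<open>peel\<close> is essential
here: a supremum exceeds the level only if some member does.\<close>

lemma peel_UN:
  assumes E: "\<And>d j. j \<in> I \<Longrightarrow> E d j \<in> sets (M j)"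
    and inc: "\<And>d j. j \<in> I \<Longrightarrow> E d j \<subseteq> E (Suc d) j" and j: "j \<in> I"
  shows "peel l (\<lambda>j. \<Union>d. E d j) j \<subseteq> (\<Union>d::nat. peel l (E d) j)"
proof
  fix x assume x: "x \<in> peel l (\<lambda>j. \<Union>d. E d j) j"
  have E_mono: "E d i \<subseteq> E d' i" if "d \<le> d'" "i \<in> I" for d d' i
    by (rule lift_Suc_mono_le[of "\<lambda>d. E d i"]) (use that inc in auto)
  obtain d0 where d0: "x \<in> E d0 j"
    using x by (auto simp: peel_def)
  then have x_space: "x \<in> space (M j)"
    using sets.sets_into_space[OF E[OF j]] by auto
  have PiE_UN: "indicator (PiE I (\<lambda>j. \<Union>d. E d j)) \<omega> = (SUP d. indicator (PiE I (E d)) \<omega> :: ennreal)" for \<omega>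
  proof (cases "\<omega> \<in> PiE I (\<lambda>j. \<Union>d. E d j)")
    case True
    then have "\<forall>i\<in>I. \<exists>d. \<omega> i \<in> E d i" by (auto simp: PiE_iff)
    then obtain d where d: "\<And>i. i \<in> I \<Longrightarrow> \<omega> i \<in> E (d i) i" by metis
    have "\<omega> i \<in> E (Max (d ` I)) i" if "i \<in> I" for i
      using d[OF that] E_mono[of "d i" "Max (d ` I)" i] finite_I that by auto
    then have "\<omega> \<in> PiE I (E (Max (d ` I)))"
      using True by (auto simp: PiE_iff)
    then have "(SUP d. indicator (PiE I (E d)) \<omega> :: ennreal) = 1"
      by (intro antisym SUP_least SUP_upper2[of "Max (d ` I)"]) (auto simp: indicator_def)
    then show ?thesis using True by simp
  next
    case False
    then have "\<omega> \<notin> PiE I (E d)" for d by (auto simp: PiE_iff)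
    then show ?thesis using False by simp
  qed
  have "slice_integral I M j (box_part (\<lambda>j. \<Union>d. E d j)) x
      = (\<integral>\<^sup>+ y. (SUP d. box_part (E d) (y(j := x))) \<partial>PiM (I - {j}) M)"
    unfolding slice_integral_def box_part_def PiE_UN by (simp add: SUP_mult_left_ennreal)
  also have "\<dots> = (SUP d. slice_integral I M j (box_part (E d)) x)"
    unfolding slice_integral_def
  proof (rule nn_integral_monotone_convergence_SUP)
    show "incseq (\<lambda>d y. box_part (E d) (y(j := x)))"
      using inc by (intro incseq_SucI le_funI)
        (auto simp: box_part_def indicator_def PiE_iff subset_iff intro!: mult_left_mono)
    show "(\<lambda>y. box_part (E d) (y(j := x))) \<in> borel_measurable (PiM (I - {j}) M)" for d
      using measurable_fun_upd_slice[of j I x M, OF j x_space] box_part_measurable[of "E d", OF E]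
      by (rule measurable_compose)
  qed
  finally have "ennreal (level l j) < (SUP d. slice_integral I M j (box_part (E d)) x)"
    using x by (simp add: peel_def)
  then obtain d1 where "ennreal (level l j) < slice_integral I M j (box_part (E d1)) x"
    by (auto simp: less_SUP_iff)
  moreover have "slice_integral I M j (box_part (E d1)) x \<le> slice_integral I M j (box_part (E (max d0 d1))) x"
    using E_mono[of d1 "max d0 d1"]
    by (intro slice_integral_mono)
      (auto simp: box_part_def indicator_def PiE_iff subset_iff intro!: mult_left_mono)
  moreover have "x \<in> E (max d0 d1) j"
    using d0 E_mono[of d0 "max d0 d1" j] j by auto
  ultimately have "x \<in> peel l (E (max d0 d1)) j"
    by (auto simp: peel_def intro: less_le_trans)
  then show "x \<in> (\<Union>d. peel l (E d) j)" by blast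
qed

text \<open>The two halves of the budget \<open>m l j\<close> go to the exhaustion and to the points that survive the peeling of
the box one scale above. The union over the number of steps keeps the bound because
the stages increase, and it is closed under peeling by \<open>peel_UN\<close>.\<close>

lemma layers_exist:
  obtains E :: "int \<Rightarrow> 'i \<Rightarrow> 'a set"
  where "\<And>l j. j \<in> I \<Longrightarrow> E l j \<in> sets (M j)"
    and "\<And>l j. j \<in> I \<Longrightarrow> emeasure (M j) (E l j) \<le> ennreal (m l j)"
    and "\<And>j. j \<in> I \<Longrightarrow> mono (\<lambda>l. E l j)"
    and "\<And>j. j \<in> I \<Longrightarrow> (\<Union>l. E l j) = space (M j)"
    and "\<And>l j. j \<in> I \<Longrightarrow> peel l (E (l + 1)) j \<subseteq> E l j"
proof -
  have "\<exists>B. (\<forall>l. B l \<in> sets (M j)) \<and> mono B \<and>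
      (\<forall>l. emeasure (M j) (B l) \<le> ennreal (m l j / 2)) \<and> (\<Union>l. B l) = space (M j)"
    if j: "j \<in> I" for j
  proof -
    have "mono (\<lambda>l. m l j / 2)"
      using monoD[OF m_mono[OF j]] by (auto intro!: monoI)
    moreover have "\<exists>l. r \<le> m l j / 2" for r
      using m_unbounded[OF j, of "2 * r"] by (auto simp: mult.commute)
    ultimately show ?thesis
      using sigma_finite_exhaustion[OF sigma_finite_M[OF j], of "\<lambda>l. m l j / 2"] by metis
  qed
  then obtain B' where B': "\<And>j. j \<in> I \<Longrightarrow> (\<forall>l. B' j l \<in> sets (M j)) \<and> mono (B' j) \<and>
      (\<forall>l. emeasure (M j) (B' j l) \<le> ennreal (m l j / 2)) \<and> (\<Union>l. B' j l) = space (M j)"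
    by metis
  define B where "B l j = B' j l" for l j
  have B_sets: "B l j \<in> sets (M j)" and B_small: "emeasure (M j) (B l j) \<le> ennreal (m l j / 2)"
    and B_mono: "k \<le> l \<Longrightarrow> B k j \<subseteq> B l j" and B_space: "(\<Union>l. B l j) = space (M j)"
    if "j \<in> I" for k l j
    using B'[OF that] by (auto simp: B_def dest: monoD)
  have stage_sets: "stage B d l j \<in> sets (M j)" if "j \<in> I" for d l j
    using that by (induction d arbitrary: l j) (auto intro!: peel_sets B_sets)
  have stage_small: "emeasure (M j) (stage B d l j) \<le> ennreal (m l j)" if "j \<in> I" for d l j
    using that
  proof (induction d arbitrary: l j)
    case 0
    then show ?case
      using B_small[of j l] m_pos[of j l] by (auto intro: order_trans ennreal_leI)
  next
    case (Suc d)
    have "emeasure (M j) (stage B (Suc d) l j)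
        \<le> emeasure (M j) (B l j) + emeasure (M j) (peel l (stage B d (l + 1)) j)"
      using Suc.prems by (auto intro!: emeasure_subadditive peel_sets stage_sets B_sets)
    also have "\<dots> \<le> ennreal (m l j / 2) + ennreal (m l j / 2)"
      using Suc by (intro add_mono B_small emeasure_peel stage_sets) auto
    also have "\<dots> = ennreal (m l j)"
      using m_pos[of j l] Suc.prems by (simp flip: ennreal_plus)
    finally show ?case .
  qed
  have stage_Suc: "stage B d l j \<subseteq> stage B (Suc d) l j" if "j \<in> I" for d l j
    using that
  proof (induction d arbitrary: l j)
    case (Suc d)
    have "peel l (stage B d (l + 1)) j \<subseteq> peel l (stage B (Suc d) (l + 1)) j"
      using Suc by (intro peel_mono)
    then show ?case by auto
  qed simp
  have stage_step: "stage B d l j \<subseteq> stage B d (l + 1) j" if "j \<in> I" for d l j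
  proof (cases d)
    case 0
    then show ?thesis using B_mono[OF that, of l "l + 1"] by simp
  next
    case (Suc d')
    have "stage B d l j \<subseteq> B (l + 1) j \<union> stage B d' (l + 1) j"
      using B_mono[OF that, of l "l + 1"] by (auto simp: Suc peel_def)
    also have "\<dots> \<subseteq> stage B d (l + 1) j"
      using stage_Suc[OF that, of d' "l + 1"] by (auto simp: Suc)
    finally show ?thesis .
  qed
  define E where "E l j = (\<Union>d. stage B d l j)" for l j
  show thesis
  proof
    fix j assume j: "j \<in> I"
    show "E l j \<in> sets (M j)" for l
      unfolding E_def using stage_sets[OF j] by auto
    show "emeasure (M j) (E l j) \<le> ennreal (m l j)" for l
    proof -
      have "emeasure (M j) (E l j) = (SUP d. emeasure (M j) (stage B d l j))"
        unfolding E_def using stage_sets[OF j] stage_Suc[OF j]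
        by (intro SUP_emeasure_incseq[symmetric] incseq_SucI) auto
      also have "\<dots> \<le> ennreal (m l j)"
        using stage_small[OF j] by (intro SUP_least)
      finally show ?thesis .
    qed
    have E_step: "E l j \<subseteq> E (l + 1) j" for l
      unfolding E_def using stage_step[OF j] by (intro SUP_mono) auto
    show "mono (\<lambda>l. E l j)"
    proof (rule monoI)
      fix k l :: int assume "k \<le> l"
      then show "E k j \<subseteq> E l j"
        by (induction l rule: int_ge_induct) (use E_step in auto)
    qed
    show "(\<Union>l. E l j) = space (M j)"
    proof
      have "B l j \<subseteq> E l j" for l
        using UN_upper[of 0 UNIV "\<lambda>d. stage B d l j"] by (simp add: E_def)
      then have "(\<Union>l. B l j) \<subseteq> (\<Union>l. E l j)"
        by (rule UN_mono[OF order_refl])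
      then show "space (M j) \<subseteq> (\<Union>l. E l j)"
        using B_space[OF j] by simp
      have "E l j \<subseteq> space (M j)" for l
        unfolding E_def by (intro UN_least sets.sets_into_space stage_sets j)
      then show "(\<Union>l. E l j) \<subseteq> space (M j)"
        by (rule UN_least)
    qed
    show "peel l (E (l + 1)) j \<subseteq> E l j" for l
    proof -
      have "peel l (E (l + 1)) j \<subseteq> (\<Union>d. peel l (stage B d (l + 1)) j)"
        unfolding E_def by (rule peel_UN) (fact stage_sets stage_Suc j)+
      also have "\<dots> \<subseteq> (\<Union>d. stage B (Suc d) l j)"
        by (intro SUP_mono) auto
      also have "\<dots> \<subseteq> E l j"
        unfolding E_def by blast
      finally show ?thesis .
    qed
  qed
qed

end

section \<open>The partition\<close>

lemma int_crossing:
  fixes k l :: int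
  assumes "P k" "\<not> P l" "l \<le> k"
  obtains i where "l \<le> i" "P (i + 1)" "\<not> P i"
proof -
  have "\<exists>i\<ge>l. P (i + 1) \<and> \<not> P i"
  proof (rule ccontr)
    assume no: "\<not> ?thesis"
    from \<open>l \<le> k\<close> have "\<not> P k"
      by (induction k rule: int_ge_induct) (use \<open>\<not> P l\<close> no in auto)
    with \<open>P k\<close> show False by simp
  qed
  with that show thesis by blast
qed

context rectangle_bound
begin

text \<open>A point is given to \<open>j\<close> when its \<open>j\<close>-th coordinate is the first to leave the decreasing boxes. The slice of
\<open>A j\<close> over \<open>x\<close> then lies in the last box whose \<open>j\<close>-th side contains \<open>x\<close>, and that slice has small mass since
\<open>x\<close> was peeled. Points that belong to all boxes may go anywhere: their coordinates
lie in every \<open>E l j\<close>, which are the sets allowed to be exceptional.\<close>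

lemma partition_exists:
  obtains A :: "'i \<Rightarrow> ('i \<Rightarrow> 'a) set"
  where "\<And>j. j \<in> I \<Longrightarrow> A j \<in> sets (PiM I M)"
    and "\<And>\<omega>. \<omega> \<in> space (PiM I M) \<Longrightarrow> \<exists>!j. j \<in> I \<and> \<omega> \<in> A j"
    and "\<And>l j. j \<in> I \<Longrightarrow>
      emeasure (M j) {x \<in> space (M j).
        ennreal (level l j) < slice_integral I M j (\<lambda>\<omega>. F \<omega> * indicator (A j) \<omega>) x} \<le> ennreal (m l j)"
proof -
  obtain E :: "int \<Rightarrow> 'i \<Rightarrow> 'a set"
    where E_sets: "\<And>l j. j \<in> I \<Longrightarrow> E l j \<in> sets (M j)"
    and E_small: "\<And>l j. j \<in> I \<Longrightarrow> emeasure (M j) (E l j) \<le> ennreal (m l j)"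
    and E_mono': "\<And>j. j \<in> I \<Longrightarrow> mono (\<lambda>l. E l j)"
    and E_space: "\<And>j. j \<in> I \<Longrightarrow> (\<Union>l. E l j) = space (M j)"
    and E_peel: "\<And>l j. j \<in> I \<Longrightarrow> peel l (E (l + 1)) j \<subseteq> E l j"
    using layers_exist by blast
  have E_mono: "E k j \<subseteq> E l j" if "j \<in> I" "k \<le> l" for j k l
    using monoD[OF E_mono'] that by blast
  define N where "N l = PiE I (E l)" for l
  define D where "D j = (\<Union>l. {\<omega> \<in> N (l + 1). \<omega> j \<notin> E l j}) \<union> (\<Inter>l. N l)" for j
  \<comment> \<open>Several coordinates may leave at the same scale, so ties go to the smallest index.\<close>
  define A where "A j = D j - (\<Union>i\<in>{i \<in> I. i < j}. D i)" for j
  have N_sets: "N l \<in> sets (PiM I M)" for l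
    unfolding N_def using finite_I E_sets by (intro sets_PiM_I_finite) auto
  have D_sets: "D j \<in> sets (PiM I M)" if j: "j \<in> I" for j
  proof -
    have "{\<omega> \<in> N (l + 1). \<omega> j \<notin> E l j} = N (l + 1) - ((\<lambda>\<omega>. \<omega> j) -` E l j \<inter> space (PiM I M))" for l
      using sets.sets_into_space[OF N_sets] by auto
    moreover have "(\<lambda>\<omega>. \<omega> j) -` E l j \<inter> space (PiM I M) \<in> sets (PiM I M)" for l
      by (rule measurable_sets[OF measurable_component_singleton]) (fact j, rule E_sets, fact j)
    ultimately show ?thesis
      unfolding D_def using N_sets by (intro sets.Un sets.countable_UN' sets.countable_INT') auto
  qed
  have N_mono: "N k \<subseteq> N l" if "k \<le> l" for k l
    unfolding N_def using E_mono that by (intro PiE_mono) auto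
  have D_cover: "\<exists>j\<in>I. \<omega> \<in> D j" if \<omega>: "\<omega> \<in> space (PiM I M)" for \<omega>
  proof (cases "\<forall>l. \<omega> \<in> N l")
    case True
    then show ?thesis using I_nonempty by (auto simp: D_def)
  next
    case False
    then obtain k where k: "\<omega> \<notin> N k" by blast
    have \<omega>_ext: "\<omega> \<in> extensional I" "\<And>i. i \<in> I \<Longrightarrow> \<omega> i \<in> space (M i)"
      using \<omega> by (auto simp: space_PiM PiE_iff)
    then have "\<forall>i\<in>I. \<exists>l. \<omega> i \<in> E l i"
      using E_space by blast
    then obtain l where l: "\<And>i. i \<in> I \<Longrightarrow> \<omega> i \<in> E (l i) i"
      by metis
    have "\<omega> i \<in> E (Max (l ` I)) i" if "i \<in> I" for i
      using l[OF that] E_mono[OF that, of "l i" "Max (l ` I)"] finite_I that by auto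
    then have "\<omega> \<in> N (Max (l ` I))"
      using \<omega>_ext by (auto simp: N_def PiE_iff)
    then have "\<omega> \<in> N (max k (Max (l ` I)))"
      using N_mono[of "Max (l ` I)" "max k (Max (l ` I))"] by auto
    then obtain i where i: "\<omega> \<in> N (i + 1)" "\<omega> \<notin> N i"
      by (rule int_crossing[of "\<lambda>l. \<omega> \<in> N l", OF _ k max.cobounded1])
    then obtain j where "j \<in> I" "\<omega> j \<notin> E i j"
      using \<omega>_ext by (auto simp: N_def PiE_iff)
    then show ?thesis using i by (auto simp: D_def)
  qed
  show thesis
  proof
    show "A j \<in> sets (PiM I M)" if "j \<in> I" for j
      unfolding A_def using D_sets that finite_I by (intro sets.Diff sets.finite_UN) auto
    show "\<exists>!j. j \<in> I \<and> \<omega> \<in> A j" if \<omega>: "\<omega> \<in> space (PiM I M)" for \<omega>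
    proof -
      define J where "J = {j \<in> I. \<omega> \<in> D j}"
      have J: "finite J" "J \<noteq> {}"
        using finite_I D_cover[OF \<omega>] by (auto simp: J_def)
      have "j \<in> I \<and> \<omega> \<in> A j \<longleftrightarrow> j = Min J" for j
        using Min_in[OF J] Min_le[OF J(1)]
        by (auto simp: A_def J_def) (metis (mono_tags, lifting) le_less mem_Collect_eq not_le)+
      then show ?thesis by auto
    qed
    fix l j assume j: "j \<in> I"
    have "slice_integral I M j (\<lambda>\<omega>. F \<omega> * indicator (A j) \<omega>) x \<le> ennreal (level l j)"
      if x: "x \<in> space (M j)" "x \<notin> E l j" for x
    proof -
      obtain k where k: "x \<in> E k j" using x(1) E_space[OF j] by blast
      then have "x \<in> E (max l k) j" using E_mono[OF j, of k "max l k"] by auto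
      then obtain i where i: "l \<le> i" "x \<in> E (i + 1) j" "x \<notin> E i j"
        by (rule int_crossing[of "\<lambda>l. x \<in> E l j", OF _ x(2) max.cobounded1])
      have in_layer: "y(j := x) \<in> N (i + 1)" if "y(j := x) \<in> A j" for y
      proof -
        have "y(j := x) \<in> D j" using that by (auto simp: A_def)
        moreover have "y(j := x) \<notin> N l" using x(2) j by (auto simp: N_def PiE_iff)
        ultimately obtain i' where i': "y(j := x) \<in> N (i' + 1)" "x \<notin> E i' j"
          by (auto simp: D_def)
        then have "x \<in> E (i' + 1) j" using j by (auto simp: N_def PiE_iff split: if_splits)
        then have "i < i' + 1"
          using E_mono[OF j, of "i' + 1" i] i(3) by force
        moreover have "i' < i + 1"
          using E_mono[OF j, of "i + 1" i'] i(2) i'(2) by force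
        ultimately have "i' = i" by simp
        then show ?thesis using i' by simp
      qed
      have "slice_integral I M j (\<lambda>\<omega>. F \<omega> * indicator (A j) \<omega>) x
          \<le> slice_integral I M j (box_part (E (i + 1))) x"
        using in_layer by (intro slice_integral_mono) (auto simp: box_part_def indicator_def N_def)
      also have "\<dots> \<le> ennreal (level i j)"
        using E_peel[OF j, of i] i by (auto simp: peel_def not_less[symmetric])
      also have "\<dots> \<le> ennreal (level l j)"
        using level_antimono[OF j i(1)] by (rule ennreal_leI)
      finally show ?thesis .
    qed
    then have "{x \<in> space (M j).
        ennreal (level l j) < slice_integral I M j (\<lambda>\<omega>. F \<omega> * indicator (A j) \<omega>) x} \<subseteq> E l j"
      by (auto simp: not_le[symmetric])
    then show "emeasure (M j) {x \<in> space (M j).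
        ennreal (level l j) < slice_integral I M j (\<lambda>\<omega>. F \<omega> * indicator (A j) \<omega>) x} \<le> ennreal (m l j)"
      using E_small[OF j] E_sets[OF j] by (meson emeasure_mono order_trans)
  qed
qed

end

section \<open>The splitting has small weak norms\<close>

lemma exponent_cases:
  assumes "0 < q" "ennreal q < p"
  obtains (infinite) "p = top" "enn2real (1 / p) = 0" "gap_exponent q p = 1 / q"
    | (finite) P where "p = ennreal P" "q < P" "enn2real (1 / p) = 1 / P" "gap_exponent q p = 1 / q - 1 / P"
proof (cases p)
  case (real P)
  with assms have "q < P" by (simp add: ennreal_less_iff)
  have "1 / p = ennreal 1 / ennreal P"
    using real by simp
  also have "\<dots> = ennreal (1 / P)"
    using assms \<open>q < P\<close> by (intro divide_ennreal) auto
  finally have "1 / p = ennreal (1 / P)" .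
  with \<open>q < P\<close> assms real finite[of P] show ?thesis by (simp add: gap_exponent_def)
next
  case top
  then show ?thesis using infinite by (simp add: gap_exponent_def)
qed

lemma gap_exponent_pos:
  assumes "0 < q" "ennreal q < p"
  shows "0 < gap_exponent q p"
  using assms
proof (cases rule: exponent_cases)
  case infinite
  then show ?thesis using assms by simp
next
  case (finite P)
  then have "1 / P < 1 / q" using assms by (intro divide_strict_left_mono) auto
  then show ?thesis using finite by simp
qed

text \<open>The measure \<open>m\<close> that solves \<open>a * m powr gap_exponent q p = 2 powr l\<close>.\<close>

definition critical_measure :: "real \<Rightarrow> ennreal \<Rightarrow> real \<Rightarrow> int \<Rightarrow> real"
  where "critical_measure q p a l = (2 powr real_of_int l / a) powr (1 / gap_exponent q p)"

lemma critical_measure_pos: "0 < a \<Longrightarrow> 0 < critical_measure q p a l"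
  by (simp add: critical_measure_def)

lemma critical_measure_powr_gap:
  assumes "0 < q" "ennreal q < p" "0 < a"
  shows "a * critical_measure q p a l powr gap_exponent q p = 2 powr real_of_int l"
  using gap_exponent_pos[OF assms(1,2)] assms(3) by (simp add: critical_measure_def powr_powr)

lemma critical_measure_mono:
  assumes "0 < q" "ennreal q < p" "0 < a"
  shows "mono (critical_measure q p a)"
  using gap_exponent_pos[OF assms(1,2)] assms(3)
  by (intro monoI) (auto simp: critical_measure_def intro!: powr_mono2 divide_right_mono)

lemma critical_measure_between:
  assumes "0 < q" "ennreal q < p" "0 < a" "0 < z"
  obtains l where "z \<le> critical_measure q p a l"
    "critical_measure q p a l \<le> 2 powr (1 / gap_exponent q p) * z"
proof
  define \<alpha> where "\<alpha> = gap_exponent q p"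
  have \<alpha>: "0 < \<alpha>" using gap_exponent_pos assms by (simp add: \<alpha>_def)
  define v where "v = a * z powr \<alpha>"
  have v: "0 < v" using assms by (simp add: v_def)
  define l where "l = \<lceil>log 2 v\<rceil>"
  have "v = 2 powr log 2 v" using v by simp
  also have "\<dots> \<le> 2 powr real_of_int l" by (intro powr_mono) (auto simp: l_def)
  finally have low: "v \<le> 2 powr real_of_int l" .
  have "2 powr real_of_int l \<le> 2 powr (log 2 v + 1)"
    by (intro powr_mono) (auto simp: l_def)
  also have "\<dots> = 2 * v" using v by (simp add: powr_add)
  finally have up: "2 powr real_of_int l \<le> 2 * v" .
  have z: "z = (v / a) powr (1 / \<alpha>)"
    using assms \<alpha> by (simp add: v_def powr_powr)
  show "z \<le> critical_measure q p a l"
    unfolding critical_measure_def \<alpha>_def[symmetric]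
    by (subst z, rule powr_mono2) (use low \<alpha> assms v in \<open>auto intro: divide_right_mono\<close>)
  have "critical_measure q p a l \<le> (2 * (v / a)) powr (1 / \<alpha>)"
    unfolding critical_measure_def \<alpha>_def[symmetric]
    using up \<alpha> assms by (intro powr_mono2) (auto simp: divide_right_mono)
  also have "\<dots> = 2 powr (1 / \<alpha>) * z"
    by (subst z, rule powr_mult)
  finally show "critical_measure q p a l \<le> 2 powr (1 / gap_exponent q p) * z"
    by (simp add: \<alpha>_def)
qed

lemma critical_measure_unbounded:
  assumes "0 < q" "ennreal q < p" "0 < a"
  shows "\<exists>l. r \<le> critical_measure q p a l"
proof -
  obtain l where "max 1 r \<le> critical_measure q p a l"
    by (rule critical_measure_between[OF assms, of "max 1 r"]) auto
  then show ?thesis by (intro exI[of _ l]) auto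
qed

lemma critical_measure_small:
  assumes "0 < q" "ennreal q < p" "0 < a" "0 < e"
  shows "\<exists>l. critical_measure q p a l < e"
proof -
  define b where "b = 2 powr (1 / gap_exponent q p)"
  have b: "0 < b" by (simp add: b_def)
  obtain l where "critical_measure q p a l \<le> b * (e / (2 * b))"
    using critical_measure_between[OF assms(1-3), of "e / (2 * b)"] b assms(4) unfolding b_def by auto
  also have "\<dots> < e" using b assms(4) by simp
  finally show ?thesis by blast
qed

text \<open>The hypothesis is the weak-type inequality sampled at the levels that belong to the measures \<open>critical_measure q p a l\<close>.
Consecutive ones differ by the factor \<open>2 powr (1 / gap_exponent q p)\<close>, which is the
loss in passing to an arbitrary level. For \<open>p = top\<close> all levels coincide, and letting \<open>l\<close> tend
to \<open>-\<infinity>\<close> gives an essential bound.\<close>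

lemma weak_Lp_norm_le_of_levels:
  assumes q: "0 < q" "ennreal q < p" and a: "0 < a" and D: "0 < D"
    and h [measurable]: "h \<in> borel_measurable N"
    and levels: "\<And>l. emeasure N {x \<in> space N.
        ennreal (D * a * critical_measure q p a l powr - enn2real (1 / p)) < h x}
      \<le> ennreal (critical_measure q p a l)"
  shows "weak_Lp_norm p N h
    \<le> ennreal (D * 2 powr (enn2real (1 / p) / gap_exponent q p) * a)"
  using q
proof (cases rule: exponent_cases)
  case infinite
  have "emeasure N {x \<in> space N. ennreal (D * a) < h x} = 0"
  proof (rule ccontr)
    assume ne: "emeasure N {x \<in> space N. ennreal (D * a) < h x} \<noteq> 0"
    obtain e where e: "0 < e" "ennreal e \<le> emeasure N {x \<in> space N. ennreal (D * a) < h x}"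
    proof (cases "emeasure N {x \<in> space N. ennreal (D * a) < h x}")
      case (real r)
      with ne show ?thesis using that[of r] by auto
    next
      case top
      then show ?thesis using that[of 1] by auto
    qed
    obtain l where l: "critical_measure q p a l < e"
      using critical_measure_small[OF q a e(1)] by blast
    have "emeasure N {x \<in> space N. ennreal (D * a) < h x} \<le> ennreal (critical_measure q p a l)"
      using levels[of l] critical_measure_pos[OF a, of q p l] by (simp add: infinite(2))
    with e(2) have "ennreal e \<le> ennreal (critical_measure q p a l)"
      by (rule order_trans)
    with l show False using e(1) critical_measure_pos[OF a, of q p l] by simp
  qed
  then have "AE x in N. h x \<le> ennreal (D * a)"
    by (subst AE_iff_measurable[OF _ refl]) (auto simp: not_le)
  then have "esssup N h \<le> ennreal (D * a)"
    by (intro esssup_I) auto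
  then show ?thesis
    unfolding weak_Lp_norm_def infinite(2) using infinite(1) by simp
next
  case (finite P)
  have P: "0 < P" using q finite by simp
  define \<alpha> where "\<alpha> = gap_exponent q p"
  have "enn_powr (ennreal (c powr P) * emeasure N {x \<in> space N. ennreal c < h x}) (1 / P)
      \<le> ennreal (D * 2 powr (1 / P / \<alpha>) * a)" if c: "0 < c" for c
  proof -
    \<comment> \<open>\<open>z\<close> is the measure whose level is exactly \<open>c\<close>.\<close>
    define z where "z = (D * a / c) powr P"
    have z: "0 < z" using D a c by (simp add: z_def)
    obtain l where l: "z \<le> critical_measure q p a l"
      "critical_measure q p a l \<le> 2 powr (1 / \<alpha>) * z"
      using critical_measure_between[OF q a z] unfolding \<alpha>_def by blast
    have "critical_measure q p a l powr - (1 / P) \<le> z powr - (1 / P)"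
      using l z P by (intro powr_mono2') auto
    also have "\<dots> = c / (D * a)"
      using P c D a by (simp add: z_def powr_powr powr_minus)
    finally have "D * a * critical_measure q p a l powr - (1 / P) \<le> c"
      using D a by (simp add: field_simps)
    then have "{x \<in> space N. ennreal c < h x} \<subseteq>
        {x \<in> space N. ennreal (D * a * critical_measure q p a l powr - enn2real (1 / p)) < h x}"
      unfolding finite(3) by (auto intro: le_less_trans[OF ennreal_leI])
    then have "emeasure N {x \<in> space N. ennreal c < h x} \<le> ennreal (critical_measure q p a l)"
      using levels[of l] by (elim order_trans[OF emeasure_mono]) auto
    also have "\<dots> \<le> ennreal (2 powr (1 / \<alpha>) * z)"
      using l(2) by (rule ennreal_leI)
    finally have "ennreal (c powr P) * emeasure N {x \<in> space N. ennreal c < h x}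
        \<le> ennreal (c powr P) * ennreal (2 powr (1 / \<alpha>) * z)"
      by (rule mult_left_mono) simp
    also have "\<dots> = ennreal (2 powr (1 / \<alpha>) * (D * a) powr P)"
      using z c D a by (subst ennreal_mult[symmetric]) (auto simp: z_def powr_divide)
    finally have "enn_powr (ennreal (c powr P) * emeasure N {x \<in> space N. ennreal c < h x}) (1 / P)
        \<le> enn_powr (ennreal (2 powr (1 / \<alpha>) * (D * a) powr P)) (1 / P)"
      using P by (intro enn_powr_mono) auto
    also have "\<dots> = ennreal ((2 powr (1 / \<alpha>) * (D * a) powr P) powr (1 / P))"
      by (rule enn_powr_ennreal) simp
    also have "(2 powr (1 / \<alpha>) * (D * a) powr P) powr (1 / P) = D * 2 powr (1 / P / \<alpha>) * a"
      using P D a by (simp add: powr_mult powr_powr mult.commute mult.left_commute)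
    finally show ?thesis .
  qed
  then show ?thesis
    unfolding weak_Lp_norm_def finite(3) using finite(1) P
    by (auto simp: \<alpha>_def intro!: SUP_least)
qed

text \<open>Peeling applies with \<open>m l j = critical_measure q (p j) (k / t j) l\<close>: on a box of scale \<open>l\<close>
each of the \<open>n\<close> terms in the hypothesis, multiplied by \<open>k\<close>, is at most \<open>2 powr l\<close>. The level of the peeling is then the \<open>q\<close>-th power of the level
in \<open>weak_Lp_norm_le_of_levels\<close>.\<close>

lemma K_functional_le:
  fixes n :: nat and M :: "nat \<Rightarrow> 'a measure" and p :: "nat \<Rightarrow> ennreal"
  assumes n: "n \<ge> 1" and sf: "\<And>j. j \<in> {1..n} \<Longrightarrow> sigma_finite_measure (M j)"
    and q: "0 < q" and p: "\<And>j. j \<in> {1..n} \<Longrightarrow> ennreal q < p j"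
    and f [measurable]: "f \<in> borel_measurable (PiM {1..n} M)"
    and t: "\<And>j. j \<in> {1..n} \<Longrightarrow> 0 < t j" and k: "0 < k"
    and rect: "\<And>E. (\<And>j. j \<in> {1..n} \<Longrightarrow> E j \<in> sets (M j)) \<Longrightarrow>
      enn_powr (\<integral>\<^sup>+ \<omega>\<in>Pi\<^sub>E {1..n} E. ennreal (\<bar>f \<omega>\<bar> powr q) \<partial>PiM {1..n} M) (1 / q)
        \<le> ennreal k * (\<Sum>j=1..n. ennreal (1 / t j) *
             enn_powr (emeasure (M j) (E j)) (gap_exponent q (p j)))"
  shows "K_functional n M q p t f
    \<le> ennreal (\<Sum>j=1..n. 2 powr (1 / q) * 2 * real n * 2 powr (enn2real (1 / p j) / gap_exponent q (p j)))
        * ennreal k"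
proof -
  define F where "F \<omega> = ennreal (\<bar>f \<omega>\<bar> powr q)" for \<omega>
  define a where "a j = k / t j" for j
  define m where "m l j = critical_measure q (p j) (a j) l" for l j
  define S where "S l = (real n * 2 powr real_of_int l) powr q" for l
  define D where "D = 2 powr (1 / q) * 2 * real n"
  have a: "0 < a j" if "j \<in> {1..n}" for j using t k that by (simp add: a_def)
  have D: "0 < D" using n by (simp add: D_def)
  have m_pos: "0 < m l j" if "j \<in> {1..n}" for l j
    unfolding m_def using a[OF that] by (rule critical_measure_pos)
  have level_eq: "2 * S (l + 1) / m l j = (D * a j * m l j powr - enn2real (1 / p j)) powr q"
    if j: "j \<in> {1..n}" for l j
  proof -
    have "D * a j * m l j powr - enn2real (1 / p j)
        = D * (a j * m l j powr gap_exponent q (p j)) * m l j powr (- 1 / q)"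
      by (simp add: gap_exponent_def powr_diff powr_minus field_simps m_pos[OF j])
    also have "\<dots> = D * 2 powr real_of_int l * m l j powr (- 1 / q)"
      unfolding m_def critical_measure_powr_gap[OF q p[OF j] a[OF j]] ..
    also have "\<dots> = 2 powr (1 / q) * (real n * 2 powr real_of_int (l + 1)) * m l j powr (- 1 / q)"
      by (simp add: D_def powr_add)
    finally have "(D * a j * m l j powr - enn2real (1 / p j)) powr q
        = 2 powr (1 / q * q) * S (l + 1) * m l j powr (- 1 / q * q)"
      by (simp only: powr_mult powr_powr S_def)
    also have "\<dots> = 2 * S (l + 1) / m l j"
      using q m_pos[OF j, of l] by (simp add: powr_minus_divide)
    finally show ?thesis by simp
  qed
  interpret rectangle_bound "{1..n}" M F m S
  proof (rule rectangle_bound.intro)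
    show "finite {1..n}" "{1..n} \<noteq> {}" using n by auto
    show "F \<in> borel_measurable (PiM {1..n} M)" unfolding F_def by measurable
    show "0 < S l" for l using n by (simp add: S_def)
  next
    fix j assume j: "j \<in> {1..n}"
    show "sigma_finite_measure (M j)" using sf[OF j] .
    show "0 < m l j" for l using m_pos[OF j] .
    show "mono (\<lambda>l. m l j)"
      unfolding m_def using critical_measure_mono[OF q p[OF j] a[OF j]] .
    show "\<exists>l. r \<le> m l j" for r
      unfolding m_def using critical_measure_unbounded[OF q p[OF j] a[OF j]] .
    show "antimono (\<lambda>l. S (l + 1) / m l j)"
    proof (rule antimonoI)
      fix l l' :: int assume "l \<le> l'"
      then have "m l j \<le> m l' j"
        unfolding m_def by (rule monoD[OF critical_measure_mono[OF q p[OF j] a[OF j]]])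
      then have "m l' j powr - enn2real (1 / p j) \<le> m l j powr - enn2real (1 / p j)"
        using m_pos[OF j] by (intro powr_mono2') auto
      then have "D * a j * m l' j powr - enn2real (1 / p j) \<le> D * a j * m l j powr - enn2real (1 / p j)"
        using a[OF j] D by (simp add: mult_left_mono)
      then have "2 * S (l' + 1) / m l' j \<le> 2 * S (l + 1) / m l j"
        unfolding level_eq[OF j] by (rule powr_mono2[rotated 2]) (use a[OF j] D q in auto)
      then show "S (l' + 1) / m l' j \<le> S (l + 1) / m l j" by simp
    qed
  next
    fix l and E :: "nat \<Rightarrow> 'a set"
    assume E: "\<And>j. j \<in> {1..n} \<Longrightarrow> E j \<in> sets (M j)"
      and small: "\<And>j. j \<in> {1..n} \<Longrightarrow> emeasure (M j) (E j) \<le> ennreal (m l j)"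
    have "enn_powr (\<integral>\<^sup>+ \<omega>. F \<omega> * indicator (PiE {1..n} E) \<omega> \<partial>PiM {1..n} M) (1 / q)
        \<le> ennreal k * (\<Sum>j=1..n. ennreal (1 / t j) *
             enn_powr (emeasure (M j) (E j)) (gap_exponent q (p j)))"
      using rect[OF E] by (simp add: F_def)
    also have "\<dots> \<le> ennreal k * (\<Sum>j=1..n. ennreal (1 / t j) *
             enn_powr (ennreal (m l j)) (gap_exponent q (p j)))"
      using small gap_exponent_pos[OF q p]
      by (intro mult_left_mono sum_mono enn_powr_mono) (auto intro: less_imp_le)
    also have "\<dots> = (\<Sum>j=1..n. ennreal (2 powr real_of_int l))"
      unfolding sum_distrib_left
    proof (rule sum.cong[OF refl])
      fix j assume j: "j \<in> {1..n}"
      have "ennreal k * (ennreal (1 / t j) * enn_powr (ennreal (m l j)) (gap_exponent q (p j)))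
          = ennreal (a j * m l j powr gap_exponent q (p j))"
        using m_pos[OF j, of l] k t[OF j] by (simp add: enn_powr_ennreal a_def flip: ennreal_mult)
      then show "ennreal k * (ennreal (1 / t j) * enn_powr (ennreal (m l j)) (gap_exponent q (p j)))
          = ennreal (2 powr real_of_int l)"
        unfolding m_def critical_measure_powr_gap[OF q p[OF j] a[OF j]] .
    qed
    also have "\<dots> = ennreal (real n * 2 powr real_of_int l)"
      by (simp add: ennreal_mult ennreal_of_nat_eq_real_of_nat)
    finally show "(\<integral>\<^sup>+ \<omega>. F \<omega> * indicator (PiE {1..n} E) \<omega> \<partial>PiM {1..n} M) \<le> ennreal (S l)"
      using q by (subst (asm) enn_powr_le_iff) (auto simp: enn_powr_ennreal S_def)
  qed
  obtain A where A_sets: "\<And>j. j \<in> {1..n} \<Longrightarrow> A j \<in> sets (PiM {1..n} M)"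
    and A_part: "\<And>\<omega>. \<omega> \<in> space (PiM {1..n} M) \<Longrightarrow> \<exists>!j. j \<in> {1..n} \<and> \<omega> \<in> A j"
    and A_level: "\<And>l j. j \<in> {1..n} \<Longrightarrow>
      emeasure (M j) {x \<in> space (M j).
        ennreal (level l j) < slice_integral {1..n} M j (\<lambda>\<omega>. F \<omega> * indicator (A j) \<omega>) x} \<le> ennreal (m l j)"
    using partition_exists by blast
  define x where "x j \<omega> = f \<omega> * indicator (A j) \<omega>" for j \<omega>
  define B where "B j = D * 2 powr (enn2real (1 / p j) / gap_exponent q (p j))" for j
  have Y_norm_le: "Y_norm n M q p j (x j) \<le> ennreal (B j * a j)" if j: "j \<in> {1..n}" for j
  proof -
    define G where "G = slice_integral {1..n} M j (\<lambda>\<omega>. F \<omega> * indicator (A j) \<omega>)"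
    note [measurable] = A_sets[OF j]
    have [measurable]: "G \<in> borel_measurable (M j)"
      unfolding G_def by (rule measurable_slice_integral[OF _ j sf]) (simp, assumption, measurable)
    have "ennreal (\<bar>x j \<omega>\<bar> powr q) = F \<omega> * indicator (A j) \<omega>" for \<omega>
      by (simp add: x_def F_def indicator_def)
    then have "Y_norm n M q p j (x j) = weak_Lp_norm (p j) (M j) (\<lambda>w. enn_powr (G w) (1 / q))"
      by (simp add: Y_norm_def Lq_norm_def G_def slice_integral_def)
    also have "\<dots> \<le> ennreal (D * 2 powr (enn2real (1 / p j) / gap_exponent q (p j)) * a j)"
    proof (rule weak_Lp_norm_le_of_levels[OF q p[OF j] a[OF j] D])
      show "(\<lambda>w. enn_powr (G w) (1 / q)) \<in> borel_measurable (M j)" by measurable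
      fix l
      have "0 \<le> D * a j * m l j powr - enn2real (1 / p j)"
        using D a[OF j] by simp
      then have "(ennreal (D * a j * m l j powr - enn2real (1 / p j)) < enn_powr (G w) (1 / q))
          \<longleftrightarrow> ennreal (level l j) < G w" for w
        using q by (simp add: less_enn_powr_iff enn_powr_ennreal level_def level_eq[OF j])
      then show "emeasure (M j) {w \<in> space (M j).
          ennreal (D * a j * critical_measure q (p j) (a j) l powr - enn2real (1 / p j))
            < enn_powr (G w) (1 / q)} \<le> ennreal (critical_measure q (p j) (a j) l)"
        using A_level[OF j, of l] by (simp add: m_def G_def)
    qed
    finally show ?thesis by (simp add: B_def)
  qed
  have "x \<in> Y_decompositions n M q p f"
    unfolding Y_decompositions_def
  proof (intro CollectI conjI ballI)
    fix j assume j: "j \<in> {1..n}"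
    note [measurable] = A_sets[OF j]
    have "x j \<in> borel_measurable (PiM {1..n} M)"
      unfolding x_def by measurable
    then show "x j \<in> Y_space n M q p j"
      using Y_norm_le[OF j] by (auto simp: Y_space_def intro: le_less_trans)
  next
    fix \<omega> assume "\<omega> \<in> space (PiM {1..n} M)"
    then obtain i where i: "i \<in> {1..n}" "\<omega> \<in> A i" "\<And>j. j \<in> {1..n} \<Longrightarrow> \<omega> \<in> A j \<Longrightarrow> j = i"
      using A_part by blast
    have "(\<Sum>j=1..n. x j \<omega>) = (\<Sum>j=1..n. if j = i then f \<omega> else 0)"
    proof (rule sum.cong[OF refl])
      fix j assume "j \<in> {1..n}"
      then show "x j \<omega> = (if j = i then f \<omega> else 0)"
        using i(2) i(3)[of j] by (cases "\<omega> \<in> A j") (auto simp: x_def)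
    qed
    then show "f \<omega> = (\<Sum>j=1..n. x j \<omega>)" using i(1) by simp
  qed
  then have "K_functional n M q p t f \<le> (\<Sum>j=1..n. ennreal (t j) * Y_norm n M q p j (x j))"
    unfolding K_functional_def by (rule INF_lower)
  also have "\<dots> \<le> (\<Sum>j=1..n. ennreal (t j) * ennreal (B j * a j))"
    using Y_norm_le by (intro sum_mono mult_left_mono) auto
  also have "\<dots> = (\<Sum>j=1..n. ennreal (B j) * ennreal k)"
  proof (rule sum.cong[OF refl])
    fix j assume j: "j \<in> {1..n}"
    have "0 \<le> B j" using D by (simp add: B_def)
    then show "ennreal (t j) * ennreal (B j * a j) = ennreal (B j) * ennreal k"
      using t[OF j] k by (simp add: a_def flip: ennreal_mult)
  qed
  also have "\<dots> = ennreal (\<Sum>j=1..n. B j) * ennreal k"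
    using D by (simp add: B_def sum_ennreal flip: sum_distrib_right)
  finally show ?thesis by (simp add: B_def D_def)
qed

section \<open>Integrals over sets of finite measure and weak norms\<close>

lemma dyadic_between:
  fixes s :: real
  assumes "1 < s"
  obtains i :: nat where "2 ^ i < s" "s \<le> 2 ^ Suc i"
proof -
  obtain k where k: "s < 2 ^ k"
    using real_arch_pow[of 2 s] by auto
  define j where "j = (LEAST j. s \<le> 2 ^ j)"
  have j: "s \<le> 2 ^ j"
    unfolding j_def using less_imp_le[OF k] by (rule LeastI)
  then obtain i where i: "j = Suc i"
    using assms by (cases j) auto
  have "\<not> s \<le> 2 ^ i"
    using not_less_Least[of i "\<lambda>j. s \<le> 2 ^ j"] i by (simp add: j_def)
  with that[of i] j i show thesis by auto
qed

text \<open>For finite \<open>h > c\<close> the term with \<open>2 ^ i * c < h \<le> 2 ^ Suc i * c\<close> already suffices. Arguing with the numbers \<open>y < h\<close>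
instead of \<open>h\<close> covers \<open>h = top\<close> as well.\<close>

lemma enn_powr_le_dyadic_sum:
  assumes q: "0 < q" and c: "0 < c"
  shows "enn_powr h q \<le> ennreal (c powr q) +
    (\<Sum>i. ennreal ((2 ^ Suc i * c) powr q) * of_bool (ennreal (2 ^ i * c) < h))"
    (is "_ \<le> _ + suminf ?u")
proof -
  have "h \<le> enn_powr (ennreal (c powr q) + suminf ?u) (1 / q)"
  proof (rule dense_le)
    fix y assume y: "y < h"
    then obtain s where s: "y = ennreal s" "0 \<le> s" by (cases y) auto
    have "enn_powr y q \<le> ennreal (c powr q) + suminf ?u"
    proof (cases "s \<le> c")
      case True
      then have "enn_powr y q \<le> ennreal (c powr q)"
        using s q by (auto simp: enn_powr_ennreal intro!: ennreal_leI powr_mono2)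
      then show ?thesis by (rule order_trans) simp
    next
      case False
      then have "1 < s / c" using c by simp
      then obtain i where i: "2 ^ i < s / c" "s / c \<le> 2 ^ Suc i"
        by (rule dyadic_between)
      have "s \<le> 2 ^ Suc i * c" using i(2) c by (simp add: pos_divide_le_eq)
      then have "enn_powr y q \<le> ennreal ((2 ^ Suc i * c) powr q)"
        unfolding s(1) enn_powr_ennreal[OF s(2)] using s(2) q by (intro ennreal_leI powr_mono2) auto
      also have "\<dots> = ?u i"
      proof -
        have "2 ^ i * c < s" using i(1) c by (simp add: pos_less_divide_eq)
        then have "ennreal (2 ^ i * c) < y"
          unfolding s(1) using c by (intro ennreal_lessI) (auto intro: le_less_trans[rotated])
        then have "ennreal (2 ^ i * c) < h" using y by (rule less_trans)
        then show ?thesis by simp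
      qed
      also have "\<dots> \<le> suminf ?u"
      proof -
        have "sum ?u {i} \<le> suminf ?u" by (rule sum_le_suminf) auto
        then show ?thesis
          by (simp only: sum.insert finite.emptyI empty_iff not_False_eq_True sum.empty add_0_right)
      qed
      finally show ?thesis by (rule order_trans) simp
    qed
    then show "y \<le> enn_powr (ennreal (c powr q) + suminf ?u) (1 / q)"
      using q by (simp add: enn_powr_le_iff)
  qed
  then show ?thesis
    using enn_powr_mono[of q h] q by (force simp: enn_powr_inverse)
qed

lemma weak_Lp_tail:
  assumes "0 < P" "0 < c"
  shows "ennreal (c powr P) * emeasure N {x \<in> space N. ennreal c < h x}
    \<le> enn_powr (weak_Lp_norm (ennreal P) N h) P"
proof -
  have "enn_powr (ennreal (c powr P) * emeasure N {x \<in> space N. ennreal c < h x}) (1 / P)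
      \<le> weak_Lp_norm (ennreal P) N h"
    unfolding weak_Lp_norm_def using assms by (auto intro!: SUP_upper2[of c])
  then show ?thesis
    using assms by (subst (asm) enn_powr_le_iff) auto
qed

text \<open>The range of \<open>h\<close> is cut dyadically above the height \<open>c = w * \<mu> powr (- 1 / P)\<close>, where the trivial bound \<open>\<mu>\<close> for the
measure of a level set inside \<open>E\<close> and the weak-type bound agree. Below it the trivial bound is used; above it the
weak-type bounds form a geometric series with ratio \<open>2 powr (q - P) < 1\<close>.\<close>

lemma nn_integral_le_weak_Lp_real:
  fixes q P w \<mu> :: real
  assumes q: "0 < q" "q < P" and h [measurable]: "h \<in> borel_measurable N"
    and E [measurable]: "E \<in> sets N"
    and w: "weak_Lp_norm (ennreal P) N h = ennreal w" "0 < w"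
    and \<mu>: "emeasure N E = ennreal \<mu>" "0 < \<mu>"
  shows "(\<integral>\<^sup>+ x\<in>E. enn_powr (h x) q \<partial>N)
    \<le> ennreal ((1 + 2 powr q / (1 - 2 powr (q - P))) * w powr q * \<mu> powr (1 - q / P))"
proof -
  define c where "c = w * \<mu> powr (- 1 / P)"
  define \<rho> where "\<rho> = 2 powr (q - P)"
  define A where "A = w powr q * \<mu> powr (1 - q / P)"
  have P: "0 < P" using q by simp
  have c: "0 < c" using w \<mu> by (simp add: c_def)
  have \<rho>: "0 < \<rho>" "\<rho> < 1" using q by (auto simp: \<rho>_def powr_less_one)
  have A: "0 < A" using w \<mu> by (simp add: A_def)
  have "\<mu> powr (- 1 / P * q) * \<mu> powr 1 = \<mu> powr (- 1 / P * q + 1)"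
    by (rule powr_add[symmetric])
  then have "\<mu> powr (- 1 / P * q) * \<mu> = \<mu> powr (1 - q / P)"
    using \<mu> by simp
  then have c_q: "c powr q * \<mu> = A"
    by (simp only: c_def A_def powr_mult powr_powr mult.assoc)
  have "c powr P * \<mu> = w powr P * (\<mu> powr (- 1 / P * P) * \<mu>)"
    by (simp only: c_def powr_mult powr_powr mult.assoc)
  also have "\<mu> powr (- 1 / P * P) * \<mu> = 1"
    using \<mu> P by (simp add: powr_minus)
  finally have c_P: "c powr P * \<mu> = w powr P" by simp
  have term_le: "ennreal ((2 ^ Suc i * c) powr q) * emeasure N {x \<in> space N. ennreal (2 ^ i * c) < h x}
      \<le> ennreal (A * 2 powr q * \<rho> ^ i)" for i
  proof -
    define d where "d = 2 ^ i * c"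
    have d: "0 < d" using c by (simp add: d_def)
    have "ennreal (d powr P) * emeasure N {x \<in> space N. ennreal d < h x} \<le> ennreal (w powr P)"
      using weak_Lp_tail[OF P d, of N h] w by (simp add: enn_powr_ennreal)
    then have "ennreal ((2 * d) powr q * d powr - P) *
          (ennreal (d powr P) * emeasure N {x \<in> space N. ennreal d < h x})
        \<le> ennreal ((2 * d) powr q * d powr - P) * ennreal (w powr P)"
      by (rule mult_left_mono) simp
    also have "ennreal ((2 * d) powr q * d powr - P) *
          (ennreal (d powr P) * emeasure N {x \<in> space N. ennreal d < h x})
        = ennreal ((2 * d) powr q * d powr - P * d powr P) * emeasure N {x \<in> space N. ennreal d < h x}"
      by (simp add: ennreal_mult mult.assoc)
    also have "(2 * d) powr q * d powr - P * d powr P = (2 * d) powr q"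
      using d by (simp add: powr_minus)
    also have "ennreal ((2 * d) powr q * d powr - P) * ennreal (w powr P)
        = ennreal (A * 2 powr q * \<rho> ^ i)"
    proof -
      have "(2 * d) powr q * d powr - P * (c powr P * \<mu>)
          = 2 powr q * d powr (q - P) * c powr P * \<mu>"
        using d by (simp add: powr_mult powr_diff powr_minus field_simps)
      also have "d powr (q - P) = \<rho> ^ i * c powr (q - P)"
        using c by (simp add: d_def \<rho>_def powr_mult powr_realpow[symmetric] powr_powr mult.commute)
      also have "2 powr q * (\<rho> ^ i * c powr (q - P)) * c powr P * \<mu> = 2 powr q * \<rho> ^ i * (c powr q * \<mu>)"
        using c by (simp add: powr_diff)
      finally have "(2 * d) powr q * d powr - P * w powr P = A * 2 powr q * \<rho> ^ i"
        unfolding c_q c_P by (simp only: mult_ac)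
      then show ?thesis by (simp flip: ennreal_mult)
    qed
    finally show ?thesis by (simp add: d_def mult.assoc)
  qed
  have "(\<integral>\<^sup>+ x\<in>E. enn_powr (h x) q \<partial>N)
      \<le> (\<integral>\<^sup>+ x. ennreal (c powr q) * indicator E x +
          (\<Sum>i. ennreal ((2 ^ Suc i * c) powr q) * indicator {x \<in> space N. ennreal (2 ^ i * c) < h x} x) \<partial>N)"
  proof (intro nn_integral_mono)
    fix x assume x: "x \<in> space N"
    have "enn_powr (h x) q * indicator E x \<le> (ennreal (c powr q) +
        (\<Sum>i. ennreal ((2 ^ Suc i * c) powr q) * indicator {x \<in> space N. ennreal (2 ^ i * c) < h x} x)) * indicator E x"
      using enn_powr_le_dyadic_sum[OF q(1) c, of "h x"] x
      by (intro mult_right_mono) (auto simp: indicator_def)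
    also have "\<dots> \<le> ennreal (c powr q) * indicator E x +
        (\<Sum>i. ennreal ((2 ^ Suc i * c) powr q) * indicator {x \<in> space N. ennreal (2 ^ i * c) < h x} x)"
      by (simp add: indicator_def)
    finally show "enn_powr (h x) q * indicator E x \<le> \<dots>" .
  qed
  also have "\<dots> = ennreal (c powr q) * emeasure N E + (\<Sum>i. ennreal ((2 ^ Suc i * c) powr q) *
      emeasure N {x \<in> space N. ennreal (2 ^ i * c) < h x})"
    by (simp add: nn_integral_add nn_integral_suminf nn_integral_cmult_indicator)
  also have "\<dots> \<le> ennreal A + (\<Sum>i. ennreal (A * 2 powr q * \<rho> ^ i))"
    using term_le c_q \<mu> by (intro add_mono suminf_le) (auto simp flip: ennreal_mult)
  also have "(\<Sum>i. ennreal (A * 2 powr q * \<rho> ^ i)) = ennreal (A * 2 powr q * (1 / (1 - \<rho>)))"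
    using A \<rho> by (intro suminf_ennreal_eq sums_mult geometric_sums) auto
  also have "ennreal A + \<dots> = ennreal (A + A * 2 powr q * (1 / (1 - \<rho>)))"
    using A \<rho> by (subst ennreal_plus) auto
  also have "A + A * 2 powr q * (1 / (1 - \<rho>)) = (1 + 2 powr q / (1 - \<rho>)) * w powr q * \<mu> powr (1 - q / P)"
    by (simp add: A_def algebra_simps)
  finally show ?thesis by (simp add: \<rho>_def)
qed

definition embedding_const :: "real \<Rightarrow> ennreal \<Rightarrow> real"
  where "embedding_const q p =
    (if p = top then 1 else (1 + 2 powr q / (1 - 2 powr (q - enn2real p))) powr (1 / q))"

lemma embedding_const_pos:
  assumes "0 < q" "ennreal q < p"
  shows "0 < embedding_const q p"
  using assms
proof (cases rule: exponent_cases)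
  case (finite P)
  then have "2 powr (q - P) < (1::real)" using assms by (simp add: powr_less_one)
  then have "0 < 1 + 2 powr q / (1 - 2 powr (q - P))" by (intro add_pos_pos) auto
  then show ?thesis using finite assms by (simp add: embedding_const_def)
qed (simp add: embedding_const_def)

text \<open>For finite \<open>p\<close> the preceding lemma covers positive finite data. In the remaining cases either the
left side vanishes or the right side is infinite; note that \<open>0 * top = 0\<close>, so a function of
weak norm zero has to be shown to vanish almost everywhere.\<close>

lemma Lq_le_weak_Lp:
  assumes q: "0 < q" "ennreal q < p" and h [measurable]: "h \<in> borel_measurable N"
    and E [measurable]: "E \<in> sets N"
  shows "enn_powr (\<integral>\<^sup>+ x\<in>E. enn_powr (h x) q \<partial>N) (1 / q)
    \<le> ennreal (embedding_const q p) * weak_Lp_norm p N h * enn_powr (emeasure N E) (gap_exponent q p)"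
  using q
proof (cases rule: exponent_cases)
  case infinite
  have "AE x in N. h x \<le> weak_Lp_norm p N h"
    unfolding weak_Lp_norm_def using infinite(1) esssup_AE[of h N] by simp
  then have "AE x in N. enn_powr (h x) q * indicator E x \<le> enn_powr (weak_Lp_norm p N h) q * indicator E x"
    by eventually_elim (use q in \<open>auto intro!: mult_right_mono enn_powr_mono\<close>)
  then have "(\<integral>\<^sup>+ x\<in>E. enn_powr (h x) q \<partial>N) \<le> (\<integral>\<^sup>+ x\<in>E. enn_powr (weak_Lp_norm p N h) q \<partial>N)"
    by (rule nn_integral_mono_AE)
  also have "\<dots> = enn_powr (weak_Lp_norm p N h) q * emeasure N E"
    by (simp add: nn_integral_cmult_indicator)
  finally have "enn_powr (\<integral>\<^sup>+ x\<in>E. enn_powr (h x) q \<partial>N) (1 / q)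
      \<le> enn_powr (enn_powr (weak_Lp_norm p N h) q * emeasure N E) (1 / q)"
    using q by (intro enn_powr_mono) auto
  also have "\<dots> = weak_Lp_norm p N h * enn_powr (emeasure N E) (1 / q)"
    using q by (simp add: enn_powr_mult enn_powr_inverse)
  finally show ?thesis using infinite by (simp add: embedding_const_def)
next
  case (finite P)
  have P: "0 < P" using q finite by simp
  have C: "0 < embedding_const q p" using q by (rule embedding_const_pos)
  consider "emeasure N E = 0" | "weak_Lp_norm p N h = 0"
    | "emeasure N E \<noteq> 0" "weak_Lp_norm p N h \<noteq> 0" "emeasure N E = top \<or> weak_Lp_norm p N h = top"
    | "emeasure N E \<noteq> 0" "weak_Lp_norm p N h \<noteq> 0" "emeasure N E < top" "weak_Lp_norm p N h < top"
    by (metis top.not_eq_extremum)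
  then show ?thesis
  proof cases
    case 1
    then have "(\<integral>\<^sup>+ x\<in>E. enn_powr (h x) q \<partial>N) = 0"
      by (intro nn_integral_null_set) auto
    then show ?thesis by simp
  next
    case 2
    have "AE x in N. h x \<le> ennreal (1 / real (Suc i))" for i
    proof -
      have "ennreal ((1 / real (Suc i)) powr P) *
          emeasure N {x \<in> space N. ennreal (1 / real (Suc i)) < h x} \<le> 0"
        using weak_Lp_tail[OF P, of "1 / real (Suc i)" N h] 2 finite(1) by simp
      then have "emeasure N {x \<in> space N. ennreal (1 / real (Suc i)) < h x} = 0"
        by simp
      then show ?thesis
        by (subst AE_iff_measurable[OF _ refl]) (auto simp: not_le)
    qed
    then have "AE x in N. \<forall>i. h x \<le> ennreal (1 / real (Suc i))"
      by (simp add: AE_all_countable)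
    then have "AE x in N. h x = 0"
    proof eventually_elim
      case (elim x)
      have "h x \<le> ennreal 0"
      proof (rule tendsto_lowerbound)
        show "(\<lambda>i. ennreal (1 / real (Suc i))) \<longlonglongrightarrow> ennreal 0"
          using LIMSEQ_inverse_real_of_nat by (intro tendsto_ennrealI) (simp add: inverse_eq_divide)
      qed (use elim in auto)
      then show ?case by simp
    qed
    then have "(\<integral>\<^sup>+ x\<in>E. enn_powr (h x) q \<partial>N) = (\<integral>\<^sup>+ x. 0 \<partial>N)"
      by (intro nn_integral_cong_AE) auto
    then show ?thesis by simp
  next
    case 3
    have "enn_powr (emeasure N E) (gap_exponent q p) \<noteq> 0"
      using 3 by (cases "emeasure N E") (auto simp: enn_powr_ennreal)
    then have "ennreal (embedding_const q p) * weak_Lp_norm p N h * enn_powr (emeasure N E) (gap_exponent q p) = top"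
      using 3 C by (auto simp: ennreal_mult_eq_top_iff)
    then show ?thesis by simp
  next
    case 4
    obtain \<mu> where \<mu>: "emeasure N E = ennreal \<mu>" "0 < \<mu>"
      using 4 by (cases "emeasure N E") (auto simp: zero_less_iff_neq_zero[symmetric])
    obtain w where w: "weak_Lp_norm p N h = ennreal w" "0 < w"
      using 4 by (cases "weak_Lp_norm p N h") (auto simp: zero_less_iff_neq_zero[symmetric])
    define B where "B = 1 + 2 powr q / (1 - 2 powr (q - P))"
    have "2 powr (q - P) < (1::real)" using finite by (simp add: powr_less_one)
    then have B: "0 < B" unfolding B_def by (intro add_pos_pos) auto
    have "enn_powr (\<integral>\<^sup>+ x\<in>E. enn_powr (h x) q \<partial>N) (1 / q)
        \<le> enn_powr (ennreal (B * w powr q * \<mu> powr (1 - q / P))) (1 / q)"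
      unfolding B_def
      using nn_integral_le_weak_Lp_real[OF q(1) finite(2) h E _ w(2) \<mu>] w(1) finite(1) q
      by (intro enn_powr_mono) auto
    also have "\<dots> = ennreal ((B * w powr q * \<mu> powr (1 - q / P)) powr (1 / q))"
      using B by (intro enn_powr_ennreal) simp
    also have "(B * w powr q * \<mu> powr (1 - q / P)) powr (1 / q)
        = B powr (1 / q) * w * \<mu> powr ((1 - q / P) * (1 / q))"
      using q w by (simp add: powr_mult powr_powr)
    also have "(1 - q / P) * (1 / q) = gap_exponent q p"
      using q P unfolding finite(4) by (simp add: field_simps)
    also have "ennreal (B powr (1 / q) * w * \<mu> powr gap_exponent q p)
        = ennreal (embedding_const q p) * weak_Lp_norm p N h * enn_powr (emeasure N E) (gap_exponent q p)"
      using w \<mu> finite(1) P by (simp add: embedding_const_def B_def enn_powr_ennreal ennreal_mult)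
    finally show ?thesis .
  qed
qed

section \<open>The two inequalities\<close>

text \<open>Only the \<open>j\<close>-th side of the box is used: enlarging the other sides to the whole space
turns the inner integral into the slice norm that enters \<open>Y_norm\<close>.\<close>

lemma box_integral_le_Y_norm:
  fixes n :: nat and M :: "nat \<Rightarrow> 'a measure" and p :: "nat \<Rightarrow> ennreal"
  assumes sf: "\<And>j. j \<in> {1..n} \<Longrightarrow> sigma_finite_measure (M j)"
    and q: "0 < q" and p: "ennreal q < p j" and j: "j \<in> {1..n}"
    and g [measurable]: "g \<in> borel_measurable (PiM {1..n} M)"
    and E: "\<And>j. j \<in> {1..n} \<Longrightarrow> E j \<in> sets (M j)"
  shows "enn_powr (\<integral>\<^sup>+ \<omega>\<in>PiE {1..n} E. ennreal (\<bar>g \<omega>\<bar> powr q) \<partial>PiM {1..n} M) (1 / q)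
    \<le> ennreal (embedding_const q (p j)) * Y_norm n M q p j g
        * enn_powr (emeasure (M j) (E j)) (gap_exponent q (p j))"
proof -
  define G where "G \<omega> = ennreal (\<bar>g \<omega>\<bar> powr q)" for \<omega>
  have G: "G \<in> borel_measurable (PiM {1..n} M)"
    unfolding G_def by measurable
  have box: "PiE {1..n} E \<in> sets (PiM {1..n} M)"
    using E by (intro sets_PiM_I_finite) auto
  define H where "H = slice_integral {1..n} M j G"
  have H [measurable]: "H \<in> borel_measurable (M j)"
    unfolding H_def by (rule measurable_slice_integral[OF _ j sf G]) simp_all
  have "(\<lambda>\<omega>. G \<omega> * indicator (PiE {1..n} E) \<omega>) \<in> borel_measurable (PiM {1..n} M)"
    using G box by measurable
  then have "(\<integral>\<^sup>+ \<omega>\<in>PiE {1..n} E. G \<omega> \<partial>PiM {1..n} M)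
      = (\<integral>\<^sup>+ x. slice_integral {1..n} M j (\<lambda>\<omega>. G \<omega> * indicator (PiE {1..n} E) \<omega>) x \<partial>M j)"
    by (intro nn_integral_slice_integral[symmetric] sf j) simp_all
  also have "\<dots> \<le> (\<integral>\<^sup>+ x\<in>E j. H x \<partial>M j)"
  proof (intro nn_integral_mono)
    fix x
    show "slice_integral {1..n} M j (\<lambda>\<omega>. G \<omega> * indicator (PiE {1..n} E) \<omega>) x \<le> H x * indicator (E j) x"
    proof (cases "x \<in> E j")
      case True
      have "slice_integral {1..n} M j (\<lambda>\<omega>. G \<omega> * indicator (PiE {1..n} E) \<omega>) x \<le> H x"
        unfolding H_def by (intro slice_integral_mono) (simp add: indicator_def)
      with True show ?thesis by simp
    next
      case False
      then have "y(j := x) \<notin> PiE {1..n} E" for y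
        using PiE_mem[of "y(j := x)" "{1..n}" E j] j by auto
      then show ?thesis by (simp add: slice_integral_def)
    qed
  qed
  also have "\<dots> = (\<integral>\<^sup>+ x\<in>E j. enn_powr (enn_powr (H x) (1 / q)) q \<partial>M j)"
    using q by (simp add: enn_powr_inverse)
  finally have "enn_powr (\<integral>\<^sup>+ \<omega>\<in>PiE {1..n} E. G \<omega> \<partial>PiM {1..n} M) (1 / q)
      \<le> enn_powr (\<integral>\<^sup>+ x\<in>E j. enn_powr (enn_powr (H x) (1 / q)) q \<partial>M j) (1 / q)"
    using q by (intro enn_powr_mono) auto
  also have "\<dots> \<le> ennreal (embedding_const q (p j)) * weak_Lp_norm (p j) (M j) (\<lambda>x. enn_powr (H x) (1 / q))
        * enn_powr (emeasure (M j) (E j)) (gap_exponent q (p j))"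
    using E[OF j] by (intro Lq_le_weak_Lp[OF q p]) measurable
  finally show ?thesis
    by (simp add: Y_norm_def Lq_norm_def H_def slice_integral_def G_def)
qed

text \<open>Each summand is estimated on the box by its own \<open>Y_norm\<close>. The weights enter through
\<open>Y_norm = (1 / t j) * (t j * Y_norm)\<close>, where the second factor is at most the whole weighted sum.\<close>

lemma rect_sup_le_decomposition:
  fixes n :: nat and M :: "nat \<Rightarrow> 'a measure" and p :: "nat \<Rightarrow> ennreal"
  assumes n: "n \<ge> 1" and sf: "\<And>j. j \<in> {1..n} \<Longrightarrow> sigma_finite_measure (M j)"
    and q: "0 < q" and p: "\<And>j. j \<in> {1..n} \<Longrightarrow> ennreal q < p j"
    and t: "\<And>j. j \<in> {1..n} \<Longrightarrow> 0 < t j"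
    and x: "x \<in> Y_decompositions n M q p f"
  shows "rect_sup n M q p t f
    \<le> ennreal (real n * real n powr (1 / q) * (\<Sum>j=1..n. embedding_const q (p j)))
        * (\<Sum>j=1..n. ennreal (t j) * Y_norm n M q p j (x j))"
  unfolding rect_sup_def
proof (rule Inf_lower, intro CollectI allI impI)
  fix E :: "nat \<Rightarrow> 'a set"
  assume E: "\<forall>j\<in>{1..n}. E j \<in> sets (M j)"
  define c where "c j = embedding_const q (p j)" for j
  define C where "C = (\<Sum>j=1..n. c j)"
  define T where "T = (\<Sum>j=1..n. ennreal (t j) * Y_norm n M q p j (x j))"
  define I where "I j = (\<integral>\<^sup>+ \<omega>\<in>PiE {1..n} E. ennreal (\<bar>x j \<omega>\<bar> powr q) \<partial>PiM {1..n} M)" for j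
  define V where "V j = enn_powr (emeasure (M j) (E j)) (gap_exponent q (p j))" for j
  have c: "0 < c j" if "j \<in> {1..n}" for j
    unfolding c_def using embedding_const_pos[OF q p[OF that]] .
  have x_meas: "x j \<in> borel_measurable (PiM {1..n} M)" if "j \<in> {1..n}" for j
    using x that by (simp add: Y_decompositions_def Y_space_def)
  have box [measurable]: "PiE {1..n} E \<in> sets (PiM {1..n} M)"
    using E by (intro sets_PiM_I_finite) auto
  have integrand_meas: "(\<lambda>\<omega>. ennreal (\<bar>x j \<omega>\<bar> powr q) * indicator (PiE {1..n} E) \<omega>)
      \<in> borel_measurable (PiM {1..n} M)" if "j \<in> {1..n}" for j
  proof -
    note [measurable] = x_meas[OF that]
    show ?thesis by measurable
  qed
  have abs_powr: "ennreal (\<bar>y\<bar> powr q) = enn_powr (ennreal \<bar>y\<bar>) q" for y :: real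
    by (simp add: enn_powr_ennreal)
  have "(\<integral>\<^sup>+ \<omega>\<in>PiE {1..n} E. ennreal (\<bar>f \<omega>\<bar> powr q) \<partial>PiM {1..n} M)
      \<le> (\<integral>\<^sup>+ \<omega>. ennreal (real n powr q) *
          (\<Sum>j=1..n. ennreal (\<bar>x j \<omega>\<bar> powr q) * indicator (PiE {1..n} E) \<omega>) \<partial>PiM {1..n} M)"
  proof (intro nn_integral_mono)
    fix \<omega> assume "\<omega> \<in> space (PiM {1..n} M)"
    then have "f \<omega> = (\<Sum>j=1..n. x j \<omega>)"
      using x by (simp add: Y_decompositions_def)
    then have "ennreal \<bar>f \<omega>\<bar> \<le> (\<Sum>j=1..n. ennreal \<bar>x j \<omega>\<bar>)"
      by (simp add: sum_ennreal ennreal_leI sum_abs)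
    then have "enn_powr (ennreal \<bar>f \<omega>\<bar>) q \<le> enn_powr (\<Sum>j=1..n. ennreal \<bar>x j \<omega>\<bar>) q"
      using q by (intro enn_powr_mono) auto
    also have "\<dots> \<le> ennreal (real n powr q) * (\<Sum>j=1..n. enn_powr (ennreal \<bar>x j \<omega>\<bar>) q)"
      using enn_powr_sum_le[OF finite_atLeastAtMost q, of "\<lambda>j. ennreal \<bar>x j \<omega>\<bar>" 1 n]
      by (simp del: sum_ennreal)
    finally have "ennreal (\<bar>f \<omega>\<bar> powr q) \<le> ennreal (real n powr q) * (\<Sum>j=1..n. ennreal (\<bar>x j \<omega>\<bar> powr q))"
      by (simp add: abs_powr)
    then show "ennreal (\<bar>f \<omega>\<bar> powr q) * indicator (PiE {1..n} E) \<omega> \<le> ennreal (real n powr q) *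
          (\<Sum>j=1..n. ennreal (\<bar>x j \<omega>\<bar> powr q) * indicator (PiE {1..n} E) \<omega>)"
      by (simp add: indicator_def)
  qed
  also have "\<dots> = ennreal (real n powr q) * (\<Sum>j=1..n. I j)"
    unfolding I_def
    by (subst nn_integral_cmult, intro borel_measurable_sum integrand_meas,
        assumption, subst nn_integral_sum, rule integrand_meas, assumption, rule refl)
  finally have "enn_powr (\<integral>\<^sup>+ \<omega>\<in>PiE {1..n} E. ennreal (\<bar>f \<omega>\<bar> powr q) \<partial>PiM {1..n} M) (1 / q)
      \<le> enn_powr (ennreal (real n powr q) * (\<Sum>j=1..n. I j)) (1 / q)"
    using q by (intro enn_powr_mono) auto
  also have "\<dots> = ennreal (real n) * enn_powr (\<Sum>j=1..n. I j) (1 / q)"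
    using q by (simp add: enn_powr_mult enn_powr_ennreal powr_powr)
  also have "\<dots> \<le> ennreal (real n) * (ennreal (real n powr (1 / q)) * (\<Sum>j=1..n. enn_powr (I j) (1 / q)))"
    using enn_powr_sum_le[of "{1..n}" "1 / q" I] q by (intro mult_left_mono) auto
  also have "\<dots> \<le> ennreal (real n) * (ennreal (real n powr (1 / q)) *
      (\<Sum>j=1..n. ennreal C * T * (ennreal (1 / t j) * V j)))"
  proof (intro mult_left_mono sum_mono)
    fix j assume j: "j \<in> {1..n}"
    have "enn_powr (I j) (1 / q) \<le> ennreal (c j) * Y_norm n M q p j (x j) * V j"
      unfolding I_def c_def V_def
      by (rule box_integral_le_Y_norm[where j = j and E = E]) (use sf q p j x_meas E in blast)+
    also have "Y_norm n M q p j (x j) = ennreal (1 / t j) * (ennreal (t j) * Y_norm n M q p j (x j))"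
      using t[OF j] by (simp add: mult.assoc[symmetric] flip: ennreal_mult)
    also have "ennreal (c j) * (ennreal (1 / t j) * (ennreal (t j) * Y_norm n M q p j (x j))) * V j
        \<le> ennreal C * (ennreal (1 / t j) * T) * V j"
    proof (intro mult_right_mono mult_mono mult_left_mono)
      show "ennreal (c j) \<le> ennreal C"
        unfolding C_def using c j by (intro ennreal_leI member_le_sum) (auto intro: less_imp_le)
      show "ennreal (t j) * Y_norm n M q p j (x j) \<le> T"
        unfolding T_def using j by (intro member_le_sum) auto
    qed auto
    finally show "enn_powr (I j) (1 / q) \<le> ennreal C * T * (ennreal (1 / t j) * V j)"
      by (simp add: mult_ac)
  qed auto
  also have "\<dots> = ennreal (real n) * ennreal (real n powr (1 / q)) * ennreal C * T *
      (\<Sum>j=1..n. ennreal (1 / t j) * V j)"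
    by (simp add: mult_ac flip: sum_distrib_left)
  also have "ennreal (real n) * ennreal (real n powr (1 / q)) * ennreal C
      = ennreal (real n * real n powr (1 / q) * C)"
  proof -
    have "0 \<le> C" unfolding C_def using c by (intro sum_nonneg) (auto intro: less_imp_le)
    then show ?thesis by (simp add: ennreal_mult)
  qed
  finally show "enn_powr (\<integral>\<^sup>+ \<omega>\<in>PiE {1..n} E. ennreal (\<bar>f \<omega>\<bar> powr q) \<partial>PiM {1..n} M) (1 / q)
      \<le> ennreal (real n * real n powr (1 / q) * (\<Sum>j=1..n. embedding_const q (p j))) * 
         (\<Sum>j=1..n. ennreal (t j) * Y_norm n M q p j (x j)) *
         (\<Sum>j=1..n. ennreal (1 / t j) * enn_powr (emeasure (M j) (E j)) (gap_exponent q (p j)))"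
    by (simp add: C_def c_def T_def V_def)
qed

theorem mainTheorem5:
  fixes n :: nat and M :: "nat \<Rightarrow> 'a measure" and q :: real and p :: "nat \<Rightarrow> ennreal"
  assumes "n \<ge> 1"
    and "\<And>j. j \<in> {1..n} \<Longrightarrow> sigma_finite_measure (M j)"
    and "0 < q"
    and "\<And>j. j \<in> {1..n} \<Longrightarrow> ennreal q < p j"
  shows "(\<forall>f\<in>borel_measurable (PiM {1..n} M).
            f \<in> Y_sum n M q p \<longleftrightarrow> rect_sup n M q p (\<lambda>_. 1) f < top) \<and>
         (\<exists>c C :: real. 0 < c \<and> 0 < C \<and>
            (\<forall>f\<in>borel_measurable (PiM {1..n} M). \<forall>t :: nat \<Rightarrow> real.
               (\<forall>j\<in>{1..n}. 0 < t j) \<longrightarrow>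
               ennreal c * rect_sup n M q p t f \<le> K_functional n M q p t f \<and>
               K_functional n M q p t f \<le> ennreal C * rect_sup n M q p t f))"
proof -
  define C where "C = (\<Sum>j=1..n. 2 powr (1 / q) * 2 * real n *
    2 powr (enn2real (1 / p j) / gap_exponent q (p j)))"
  define B where "B = real n * real n powr (1 / q) * (\<Sum>j=1..n. embedding_const q (p j))"
  have C: "0 < C"
    unfolding C_def using assms(1) by (intro sum_pos) auto
  have "0 < (\<Sum>j=1..n. embedding_const q (p j))"
    using assms embedding_const_pos by (intro sum_pos) auto
  then have B: "0 < B"
    unfolding B_def using assms(1) by simp
  have lower: "ennreal (1 / B) * rect_sup n M q p t f \<le> K_functional n M q p t f"
    if t: "\<forall>j\<in>{1..n}. 0 < t j" for t f
    unfolding K_functional_def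
  proof (rule INF_greatest)
    fix x assume x: "x \<in> Y_decompositions n M q p f"
    have "rect_sup n M q p t f \<le> ennreal B * (\<Sum>j=1..n. ennreal (t j) * Y_norm n M q p j (x j))"
      unfolding B_def using assms t x by (intro rect_sup_le_decomposition) auto
    then have "ennreal (1 / B) * rect_sup n M q p t f
        \<le> ennreal (1 / B) * (ennreal B * (\<Sum>j=1..n. ennreal (t j) * Y_norm n M q p j (x j)))"
      by (rule mult_left_mono) simp
    also have "\<dots> = (\<Sum>j=1..n. ennreal (t j) * Y_norm n M q p j (x j))"
      using B by (simp add: mult.assoc[symmetric] flip: ennreal_mult)
    finally show "ennreal (1 / B) * rect_sup n M q p t f \<le> \<dots>" .
  qed
  have upper: "K_functional n M q p t f \<le> ennreal C * rect_sup n M q p t f"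
    if f: "f \<in> borel_measurable (PiM {1..n} M)" and t: "\<forall>j\<in>{1..n}. 0 < t j" for t f
  proof -
    have "ennreal (1 / C) * K_functional n M q p t f \<le> rect_sup n M q p t f"
    \<comment> \<open>Peeling needs a positive finite \<open>k\<close>, so it is applied above the supremum, which may be \<open>0\<close>.\<close>
    proof (rule dense_ge)
      fix k assume k: "rect_sup n M q p t f < k"
      show "ennreal (1 / C) * K_functional n M q p t f \<le> k"
      proof (cases k)
        case (real r)
        have r: "0 < r" using k real by (cases "r = 0") auto
        obtain k' where k': "k' < k" and bound: "\<And>E. (\<forall>j\<in>{1..n}. E j \<in> sets (M j)) \<Longrightarrow>
            enn_powr (\<integral>\<^sup>+ \<omega>\<in>Pi\<^sub>E {1..n} E. ennreal (\<bar>f \<omega>\<bar> powr q) \<partial>PiM {1..n} M) (1 / q)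
            \<le> k' * (\<Sum>j=1..n. ennreal (1 / t j) *
                     enn_powr (emeasure (M j) (E j)) (gap_exponent q (p j)))"
          using k unfolding rect_sup_def by (auto simp: Inf_less_iff)
        have "K_functional n M q p t f \<le> ennreal C * ennreal r"
          unfolding C_def
        proof (rule K_functional_le)
          fix E :: "nat \<Rightarrow> 'a set"
          let ?rhs = "\<Sum>j=1..n. ennreal (1 / t j) *
                     enn_powr (emeasure (M j) (E j)) (gap_exponent q (p j))"
          assume "\<And>j. j \<in> {1..n} \<Longrightarrow> E j \<in> sets (M j)"
          then have "enn_powr (\<integral>\<^sup>+ \<omega>\<in>Pi\<^sub>E {1..n} E. ennreal (\<bar>f \<omega>\<bar> powr q) \<partial>PiM {1..n} M) (1 / q)
            \<le> k' * ?rhs"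
            by (intro bound ballI)
          also have "\<dots> \<le> ennreal r * ?rhs"
            using k' real by (intro mult_right_mono) auto
          finally show "enn_powr (\<integral>\<^sup>+ \<omega>\<in>Pi\<^sub>E {1..n} E. ennreal (\<bar>f \<omega>\<bar> powr q) \<partial>PiM {1..n} M) (1 / q)
            \<le> ennreal r * ?rhs" .
        qed (use assms f t r in auto)
        then have "ennreal (1 / C) * K_functional n M q p t f \<le> ennreal (1 / C) * (ennreal C * ennreal r)"
          by (rule mult_left_mono) simp
        also have "\<dots> = k"
          using C real by (simp add: mult.assoc[symmetric] flip: ennreal_mult)
        finally show ?thesis .
      qed simp
    qed
    then have "ennreal C * (ennreal (1 / C) * K_functional n M q p t f) \<le> ennreal C * rect_sup n M q p t f"
      by (rule mult_left_mono) simp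
    moreover have "ennreal C * (ennreal (1 / C) * K_functional n M q p t f) = K_functional n M q p t f"
      using C by (simp add: mult.assoc[symmetric] flip: ennreal_mult)
    ultimately show ?thesis by simp
  qed
  have "f \<in> Y_sum n M q p \<longleftrightarrow> rect_sup n M q p (\<lambda>_. 1) f < top"
    if f: "f \<in> borel_measurable (PiM {1..n} M)" for f
  proof
    assume "f \<in> Y_sum n M q p"
    then obtain x where x: "x \<in> Y_decompositions n M q p f" by (auto simp: Y_sum_def)
    then have "Y_norm n M q p j (x j) < top" if "j \<in> {1..n}" for j
      using that by (simp add: Y_decompositions_def Y_space_def)
    then have "ennreal B * (\<Sum>j=1..n. ennreal 1 * Y_norm n M q p j (x j)) < top"
      by (auto simp: ennreal_mult_less_top)
    moreover have "rect_sup n M q p (\<lambda>_. 1) f \<le> ennreal B * (\<Sum>j=1..n. ennreal 1 * Y_norm n M q p j (x j))"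
      unfolding B_def using rect_sup_le_decomposition[OF assms(1-4) _ x, of "\<lambda>_. 1"] by simp
    ultimately show "rect_sup n M q p (\<lambda>_. 1) f < top" by (rule le_less_trans[rotated])
  next
    assume "rect_sup n M q p (\<lambda>_. 1) f < top"
    then have "K_functional n M q p (\<lambda>_. 1) f < top"
      using upper[OF f, of "\<lambda>_. 1"] by (auto intro: le_less_trans simp: ennreal_mult_less_top)
    then show "f \<in> Y_sum n M q p"
      by (auto simp: Y_sum_def K_functional_def)
  qed
  moreover have "0 < 1 / B" using B by simp
  ultimately show ?thesis using C lower upper by blast
qed

end
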